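(* Let $(X,d)$ be a compact metric space, $T:X\to X$ a continuous map, $\Phi=\{\varphi_n:X\to\mathbb{R}\}_{n\in\mathbb{N}}$ a sequence of continuous functions, and $Z$ a non-empty compact subset of $X$. Assume that $\Phi$ satisfies the tempered distortion condition $$\lim_{\varepsilon\to 0}\limsup_{n\to\infty}\frac{\varphi_n(\varepsilon)}{n}=0,\qquad\text{where } \varphi_n(\varepsilon)=\sup\{|\varphi_n(x)-\varphi_n(y)|: x\in X,\ y\in B_n(x,e^{-n\varepsilon})\}.$$ Then $$P^{\tilde B}_Z(T,\Phi)=\lim_{\varepsilon\to 0}\sup\{\underline{P}^{\widetilde{BK}}_\mu(T,\Phi,\varepsilon):\mu\in M(X),\ \mu(Z)=1\}=\lim_{\varepsilon\to 0}\sup\{P^{\widetilde K}_\mu(T,\Phi,\varepsilon):\mu\in M(X),\ \mu(Z)=1\}.$$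
   Context: $M(X)$ is the set of Borel probability measures on $X$. For $n\in\mathbb{N}$, $x\in X$, $\varepsilon>0$, the neutralized Bowen ball is $B_n(x,e^{-n\varepsilon})=\{y\in X: d(T^jx,T^jy)<e^{-n\varepsilon}\ \forall\, 0\le j\le n-1\}$. Neutralized Bowen pressure: for $Z\subset X$, $\varepsilon>0$, $N\in\mathbb{N}$, $s\in\mathbb{R}$, let $M^s_{N,\varepsilon}(Z,\Phi)=\inf\sum_{i\in I}\exp[-n_is+\sup_{y\in B_{n_i}(x_i,e^{-n_i\varepsilon})}\varphi_{n_i}(y)]$, the infimum over all finite or countable covers $\{B_{n_i}(x_i,e^{-n_i\varepsilon})\}_{i\in I}$ of $Z$ with $n_i\ge N$, $x_i\in X$. Let $M^s_\varepsilon(Z,\Phi)=\lim_{N\to\infty}M^s_{N,\varepsilon}(Z,\Phi)$, $M_\varepsilon(Z,\Phi)=\inf\{s:M^s_\varepsilon(Z,\Phi)=0\}=\sup\{s:M^s_\varepsilon(Z,\Phi)=\infty\}$, and $P^{\tilde B}_Z(T,\Phi)=\lim_{\varepsilon\to0}M_\varepsilon(Z,\Phi)$. Lower neutralized Brin–Katok local pressure at scale $\varepsilon$: for $\mu\in M(X)$, $\underline{P}^{\widetilde{BK}}_\mu(T,\Phi,\varepsilon,x)=\liminf_{n\to\infty}\frac{-\log\mu(B_n(x,e^{-n\varepsilon}))+\varphi_n(x)}{n}$ and $\underline{P}^{\widetilde{BK}}_\mu(T,\Phi,\varepsilon)=\int\underline{P}^{\widetilde{BK}}_\mu(T,\Phi,\varepsilon,x)\,d\mu(x)$.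 Neutralized Katok pressure at scale $\varepsilon$: for $\mu\in M(X)$, $\delta\in(0,1)$, let $\Lambda^s_{N,\varepsilon}(\mu,\Phi,\delta)=\inf\sum_{i\in I}\exp[-n_is+\sup_{y\in B_{n_i}(x_i,e^{-n_i\varepsilon})}\varphi_{n_i}(y)]$, the infimum over all finite or countable families $\{B_{n_i}(x_i,e^{-n_i\varepsilon})\}_{i\in I}$ with $n_i\ge N$, $x_i\in X$ and $\mu(\bigcup_iB_{n_i}(x_i,e^{-n_i\varepsilon}))>1-\delta$; $\Lambda^s_\varepsilon(\mu,\Phi,\delta)=\lim_{N\to\infty}\Lambda^s_{N,\varepsilon}(\mu,\Phi,\delta)$; $\Lambda_\varepsilon(\mu,\Phi,\delta)=\inf\{s:\Lambda^s_\varepsilon(\mu,\Phi,\delta)=0\}=\sup\{s:\Lambda^s_\varepsilon(\mu,\Phi,\delta)=\infty\}$; and $P^{\widetilde K}_\mu(T,\Phi,\varepsilon)=\lim_{\delta\to0}\Lambda_\varepsilon(\mu,\Phi,\delta)$. *)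

theory Defs
  imports "HOL-Probability.Probability"
begin

definition bowen_ball :: "('a::metric_space \<Rightarrow> 'a) \<Rightarrow> nat \<Rightarrow> 'a \<Rightarrow> real \<Rightarrow> 'a set" where
  "bowen_ball T n x r = {y. \<forall>j<n. dist ((T ^^ j) x) ((T ^^ j) y) < r}"

definition nball :: "('a::metric_space \<Rightarrow> 'a) \<Rightarrow> nat \<Rightarrow> 'a \<Rightarrow> real \<Rightarrow> 'a set" where
  "nball T n x eps = bowen_ball T n x (exp (- real n * eps))"

definition family_sum :: "('a::metric_space \<Rightarrow> 'a) \<Rightarrow> (nat \<Rightarrow> 'a \<Rightarrow> real) \<Rightarrow> real \<Rightarrow> real
    \<Rightarrow> nat set \<Rightarrow> (nat \<Rightarrow> 'a) \<Rightarrow> (nat \<Rightarrow> nat) \<Rightarrow> ennreal" where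
  "family_sum T phi s eps I x n =
     (\<Sum>i. if i \<in> I then ennreal (exp (- real (n i) * s
            + (SUP y\<in>nball T (n i) (x i) eps. phi (n i) y))) else 0)"

definition MN :: "('a::metric_space \<Rightarrow> 'a) \<Rightarrow> (nat \<Rightarrow> 'a \<Rightarrow> real) \<Rightarrow> 'a set \<Rightarrow> real \<Rightarrow> real \<Rightarrow> nat \<Rightarrow> ennreal" where
  "MN T phi Z s eps N = Inf {family_sum T phi s eps I x n | I x n.
      (\<forall>i\<in>I. N \<le> n i) \<and> Z \<subseteq> (\<Union>i\<in>I. nball T (n i) (x i) eps)}"

text \<open>The limit N to infinity of the nondecreasing sequence MN is its supremum.\<close>
definition Ms :: "('a::metric_space \<Rightarrow> 'a) \<Rightarrow> (nat \<Rightarrow> 'a \<Rightarrow> real) \<Rightarrow> 'a set \<Rightarrow> real \<Rightarrow> real \<Rightarrow> ennreal" where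
  "Ms T phi Z s eps = (SUP N. MN T phi Z s eps N)"

definition Meps :: "('a::metric_space \<Rightarrow> 'a) \<Rightarrow> (nat \<Rightarrow> 'a \<Rightarrow> real) \<Rightarrow> 'a set \<Rightarrow> real \<Rightarrow> ereal" where
  "Meps T phi Z eps = Inf {ereal s | s. Ms T phi Z s eps = 0}"

definition neutral_bowen_pressure :: "('a::metric_space \<Rightarrow> 'a) \<Rightarrow> (nat \<Rightarrow> 'a \<Rightarrow> real) \<Rightarrow> 'a set \<Rightarrow> ereal" where
  "neutral_bowen_pressure T phi Z = Lim (at_right 0) (Meps T phi Z)"

definition neglog :: "ennreal \<Rightarrow> ereal" where
  "neglog a = (if a = 0 then \<infinity> else ereal (- ln (enn2real a)))"

definition ereal_integral :: "'a measure \<Rightarrow> ('a \<Rightarrow> ereal) \<Rightarrow> ereal" where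
  "ereal_integral M f = enn2ereal (\<integral>\<^sup>+ x. e2ennreal (f x) \<partial>M) - enn2ereal (\<integral>\<^sup>+ x. e2ennreal (- f x) \<partial>M)"

definition lowerBK_local :: "'a measure \<Rightarrow> ('a::metric_space \<Rightarrow> 'a) \<Rightarrow> (nat \<Rightarrow> 'a \<Rightarrow> real) \<Rightarrow> real \<Rightarrow> 'a \<Rightarrow> ereal" where
  "lowerBK_local \<mu> T phi eps x =
     liminf (\<lambda>n. (neglog (emeasure \<mu> (nball T n x eps)) + ereal (phi n x)) / ereal (real n))"

definition lowerBK :: "'a measure \<Rightarrow> ('a::metric_space \<Rightarrow> 'a) \<Rightarrow> (nat \<Rightarrow> 'a \<Rightarrow> real) \<Rightarrow> real \<Rightarrow> ereal" where
  "lowerBK \<mu> T phi eps = ereal_integral \<mu> (lowerBK_local \<mu> T phi eps)"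

definition LambdaN :: "'a measure \<Rightarrow> ('a::metric_space \<Rightarrow> 'a) \<Rightarrow> (nat \<Rightarrow> 'a \<Rightarrow> real) \<Rightarrow> real \<Rightarrow> real \<Rightarrow> real \<Rightarrow> nat \<Rightarrow> ennreal" where
  "LambdaN \<mu> T phi delta s eps N = Inf {family_sum T phi s eps I x n | I x n.
      (\<forall>i\<in>I. N \<le> n i) \<and> emeasure \<mu> (\<Union>i\<in>I. nball T (n i) (x i) eps) > ennreal (1 - delta)}"

definition Lambdas :: "'a measure \<Rightarrow> ('a::metric_space \<Rightarrow> 'a) \<Rightarrow> (nat \<Rightarrow> 'a \<Rightarrow> real) \<Rightarrow> real \<Rightarrow> real \<Rightarrow> real \<Rightarrow> ennreal" where
  "Lambdas \<mu> T phi delta s eps = (SUP N. LambdaN \<mu> T phi delta s eps N)"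

definition Lambda_eps :: "'a measure \<Rightarrow> ('a::metric_space \<Rightarrow> 'a) \<Rightarrow> (nat \<Rightarrow> 'a \<Rightarrow> real) \<Rightarrow> real \<Rightarrow> real \<Rightarrow> ereal" where
  "Lambda_eps \<mu> T phi delta eps = Inf {ereal s | s. Lambdas \<mu> T phi delta s eps = 0}"

definition katok :: "'a measure \<Rightarrow> ('a::metric_space \<Rightarrow> 'a) \<Rightarrow> (nat \<Rightarrow> 'a \<Rightarrow> real) \<Rightarrow> real \<Rightarrow> ereal" where
  "katok \<mu> T phi eps = Lim (at_right 0) (\<lambda>delta. Lambda_eps \<mu> T phi delta eps)"

definition probs_on :: "'a::metric_space set \<Rightarrow> 'a measure set" where
  "probs_on Z = {\<mu>. prob_space \<mu> \<and> sets \<mu> = sets borel \<and> emeasure \<mu> Z = 1}"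

definition distortion :: "('a::metric_space \<Rightarrow> 'a) \<Rightarrow> (nat \<Rightarrow> 'a \<Rightarrow> real) \<Rightarrow> nat \<Rightarrow> real \<Rightarrow> real" where
  "distortion T phi n eps = (SUP (x, y)\<in>{(x, y). y \<in> nball T n x eps}. \<bar>phi n x - phi n y\<bar>)"

definition tempered_distortion :: "('a::metric_space \<Rightarrow> 'a) \<Rightarrow> (nat \<Rightarrow> 'a \<Rightarrow> real) \<Rightarrow> bool" where
  "tempered_distortion T phi \<longleftrightarrow>
     ((\<lambda>eps. limsup (\<lambda>n. ereal (distortion T phi n eps / real n))) \<longlongrightarrow> 0) (at_right 0)"

end

theory Submission
  imports Defs
begin

text \<open>
  Tempered distortion makes \<open>Meps T phi Z\<close> monotone in the scale up to an arbitrarily small error, so its limit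
  at 0 exists, and it suffices to compare the three quantities at comparable scales:
  \<open>Meps eps - eta \<le> sup lowerBK (2 * eps)\<close>, \<open>lowerBK eps \<le> katok (2 * eps)\<close> and \<open>katok eps \<le> Meps eps\<close>.
  The last two are covering estimates. The first is a Frostman lemma: replacing a weighted cover at scale
  \<open>2 * eps\<close> by balls of scale \<open>eps\<close> with separated centres bounds its total weight from below, and
  Hahn--Banach turns this bound into a finitely additive charge on all subsets of the space that is small on
  every neutralized Bowen ball. The Borel measure is the outer measure generated by the charge of open sets; by
  compactness it still gives \<open>Z\<close> full mass, and it is at most the charge on open sets.
\<close>

section \<open>Linear functionals below a sublinear functional\<close>

text \<open>The covering step of a Frostman argument enlarges balls by a constant factor. The radius
  \<open>exp (- n * eps)\<close> absorbs such a factor for large \<open>n\<close> when the scale is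
  doubled; this is the origin of the factors 2 between scales, and a fixed factor does not move a
  limit at 0. Indicators of open balls are not continuous, so the functional is built on all bounded
  functions: there the bound on a ball is an instance of domination by the cost of weighted covers.
  The price is countable additivity. Passing to the outer measure of open covers restores it and
  keeps only an upper bound on open sets, which is the direction needed, since the balls are open.
  The local pressure \<open>lowerBK_local\<close> and the sets where it is large are never shown to
  be measurable. Bounds on its integral therefore rest on monotonicity alone, and the comparison
  with the Katok pressure works with outer measures. All pressures may be infinite, so errors are
  real numbers added on the larger side of an inequality.\<close>

definition sublinear :: "('v::real_vector \<Rightarrow> real) \<Rightarrow> bool" where
  "sublinear p \<longleftrightarrow> (\<forall>x y. p (x + y) \<le> p x + p y) \<and> (\<forall>t x. 0 \<le> t \<longrightarrow> p (t *\<^sub>R x) = t * p x)"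

lemma sublinear_add: "sublinear p \<Longrightarrow> p (x + y) \<le> p x + p y"
  and sublinear_scale: "sublinear p \<Longrightarrow> 0 \<le> t \<Longrightarrow> p (t *\<^sub>R x) = t * p x"
  by (auto simp: sublinear_def)

lemma sublinear_zero: "sublinear p \<Longrightarrow> p 0 = 0"
  using sublinear_scale[of p 0 0] by simp

lemma sublinear_neg: "sublinear p \<Longrightarrow> - p (- x) \<le> p x"
  using sublinear_add[of p x "-x"] sublinear_zero[of p] by simp

text \<open>Applying the one-sided scaling bound with \<open>inverse t\<close> at the point
  \<open>t *\<^sub>R x\<close> gives the reverse inequality.\<close>

lemma sublinearI:
  fixes p :: "'v::real_vector \<Rightarrow> real"
  assumes "\<And>x y. p (x + y) \<le> p x + p y" "\<And>t x. 0 < t \<Longrightarrow> p (t *\<^sub>R x) \<le> t * p x" "p 0 = 0"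
  shows "sublinear p"
proof -
  have "p (t *\<^sub>R x) = t * p x" if "0 \<le> t" for t x
  proof (cases "t = 0")
    case False
    then have t: "0 < t" using that by simp
    have "p x = p (inverse t *\<^sub>R (t *\<^sub>R x))" using t by simp
    also have "\<dots> \<le> inverse t * p (t *\<^sub>R x)" using t by (intro assms) auto
    finally have "t * p x \<le> p (t *\<^sub>R x)" using t by (simp add: field_simps)
    then show ?thesis using assms(2)[OF t, of x] by simp
  qed (use assms in simp)
  then show ?thesis using assms by (auto simp: sublinear_def)
qed

text \<open>\<open>q x\<close> is the infimum of \<open>p (x + t *\<^sub>R v) - t * p v\<close> over
  \<open>t \<ge> 0\<close>; subadditivity bounds it below by \<open>- p (- x)\<close>. The
  parameters 0 and 1 give the two upper bounds. For a minimal \<open>p\<close> the result is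
  \<open>p\<close> itself, and the second bound becomes superadditivity in the direction
  \<open>v\<close>.\<close>

lemma sublinear_lower_in_direction:
  fixes p :: "'v::real_vector \<Rightarrow> real"
  assumes p: "sublinear p"
  obtains q where "sublinear q" "\<And>x. q x \<le> p x" "\<And>x. q x \<le> p (x + v) - p v"
proof -
  define S where "S x = {p (x + t *\<^sub>R v) - t * p v | t. 0 \<le> t}" for x
  define q where "q x = Inf (S x)" for x
  have mem: "p (x + t *\<^sub>R v) - t * p v \<in> S x" if "0 \<le> t" for t x
    using that by (auto simp: S_def)
  have low: "- p (- x) \<le> y" if y: "y \<in> S x" for x y
  proof -
    obtain t where t: "0 \<le> t" "y = p (x + t *\<^sub>R v) - t * p v" using y by (auto simp: S_def)
    have "p (t *\<^sub>R v) \<le> p (x + t *\<^sub>R v) + p (- x)"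
      using sublinear_add[OF p, of "x + t *\<^sub>R v" "-x"] by simp
    then show ?thesis using t by (simp add: sublinear_scale[OF p])
  qed
  have bdd: "bdd_below (S x)" for x using low by (auto intro!: bdd_belowI)
  have ne: "S x \<noteq> {}" for x using mem[of 0 x] by auto
  have le: "q x \<le> p (x + t *\<^sub>R v) - t * p v" if "0 \<le> t" for t x
    unfolding q_def by (rule cInf_lower[OF mem[OF that] bdd])
  have "sublinear q"
  proof (rule sublinearI)
    fix x y
    have "q (x + y) \<le> a + b" if ab: "a \<in> S x" "b \<in> S y" for a b
    proof -
      obtain t u where t: "0 \<le> t" "a = p (x + t *\<^sub>R v) - t * p v"
        and u: "0 \<le> u" "b = p (y + u *\<^sub>R v) - u * p v" using ab by (auto simp: S_def)
      have "q (x + y) \<le> p (x + y + (t + u) *\<^sub>R v) - (t + u) * p v" using t u by (intro le) auto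
      also have "x + y + (t + u) *\<^sub>R v = (x + t *\<^sub>R v) + (y + u *\<^sub>R v)" by (simp add: algebra_simps)
      also have "p \<dots> - (t + u) * p v \<le> a + b"
        using sublinear_add[OF p, of "x + t *\<^sub>R v" "y + u *\<^sub>R v"] t u by (simp add: algebra_simps)
      finally show ?thesis .
    qed
    then have "q (x + y) - b \<le> q x" if "b \<in> S y" for b
      unfolding q_def[of x] using that by (intro cInf_greatest[OF ne]) (force simp: algebra_simps)
    then have "q (x + y) - q x \<le> q y"
      unfolding q_def[of y] by (intro cInf_greatest[OF ne]) (force simp: algebra_simps)
    then show "q (x + y) \<le> q x + q y" by simp
  next
    fix t :: real and x assume t: "0 < t"
    have "q (t *\<^sub>R x) / t \<le> a" if a: "a \<in> S x" for a
    proof -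
      obtain u where u: "0 \<le> u" "a = p (x + u *\<^sub>R v) - u * p v" using a by (auto simp: S_def)
      have "q (t *\<^sub>R x) \<le> p (t *\<^sub>R x + (t * u) *\<^sub>R v) - (t * u) * p v" using t u by (intro le) auto
      also have "t *\<^sub>R x + (t * u) *\<^sub>R v = t *\<^sub>R (x + u *\<^sub>R v)" by (simp add: algebra_simps)
      also have "p \<dots> = t * p (x + u *\<^sub>R v)" using t by (intro sublinear_scale[OF p]) simp
      also have "\<dots> - t * u * p v = t * a" unfolding u(2) by (simp add: algebra_simps)
      finally show ?thesis using t by (simp add: field_simps)
    qed
    then have "q (t *\<^sub>R x) / t \<le> q x" unfolding q_def[of x] by (intro cInf_greatest[OF ne])
    then show "q (t *\<^sub>R x) \<le> t * q x" using t by (simp add: field_simps)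
  next
    have "q 0 \<ge> 0" unfolding q_def
      using low[of _ 0] sublinear_zero[OF p] by (intro cInf_greatest[OF ne]) auto
    moreover have "q 0 \<le> 0" using le[of 0 0] sublinear_zero[OF p] by simp
    ultimately show "q 0 = 0" by simp
  qed
  moreover have "q x \<le> p x" for x using le[of 0 x] by simp
  moreover have "q x \<le> p (x + v) - p v" for x using le[of 1 x] by simp
  ultimately show ?thesis by (rule that)
qed

text \<open>Lower bounds for Zorn's lemma. All members lie below the same \<open>p\<close>, so
  \<open>- p (- x)\<close> bounds their values at \<open>x\<close> from below and the pointwise
  infimum is finite. Subadditivity survives because any two members of a chain have a member below
  both.\<close>

lemma sublinear_chain_Inf:
  fixes C :: "('v::real_vector \<Rightarrow> real) set"
  assumes ne: "C \<noteq> {}" and sub: "\<And>q. q \<in> C \<Longrightarrow> sublinear q \<and> q \<le> p"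
    and chain: "\<And>q q'. q \<in> C \<Longrightarrow> q' \<in> C \<Longrightarrow> q \<le> q' \<or> q' \<le> q"
  obtains u where "sublinear u" "\<And>q. q \<in> C \<Longrightarrow> u \<le> q"
proof -
  define u where "u x = (INF q\<in>C. q x)" for x
  have bdd: "bdd_below ((\<lambda>q. q x) ` C)" for x
  proof (rule bdd_belowI2)
    fix q assume "q \<in> C"
    then have "q (-x) \<le> p (-x)" "- q (- x) \<le> q x" using sub sublinear_neg by (auto simp: le_fun_def)
    then show "- p (- x) \<le> q x" by linarith
  qed
  have le: "u x \<le> q x" if "q \<in> C" for q x
    unfolding u_def by (rule cINF_lower[OF bdd that])
  have "sublinear u"
  proof (rule sublinearI)
    fix x y
    have *: "u (x + y) \<le> q x + q' y" if q: "q \<in> C" "q' \<in> C" for q q'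
    proof -
      obtain r where r: "r \<in> C" "r \<le> q" "r \<le> q'" using chain[OF q] q by blast
      have "u (x + y) \<le> r (x + y)" by (rule le[OF r(1)])
      also have "\<dots> \<le> r x + r y" using sub[OF r(1)] sublinear_add by blast
      also have "\<dots> \<le> q x + q' y" using r by (intro add_mono) (auto simp: le_fun_def)
      finally show ?thesis .
    qed
    have "u (x + y) - q' y \<le> u x" if "q' \<in> C" for q'
      unfolding u_def[of x] using *[OF _ that] by (intro cINF_greatest[OF ne]) (force simp: algebra_simps)
    then have "u (x + y) - u x \<le> u y"
      unfolding u_def[of y] by (intro cINF_greatest[OF ne]) (force simp: algebra_simps)
    then show "u (x + y) \<le> u x + u y" by simp
  next
    fix t :: real and x assume t: "0 < t"
    have "u (t *\<^sub>R x) / t \<le> q x" if "q \<in> C" for q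
      using le[OF that, of "t *\<^sub>R x"] sub[OF that] t by (auto simp: sublinear_scale field_simps)
    then have "u (t *\<^sub>R x) / t \<le> u x" unfolding u_def[of x] by (intro cINF_greatest[OF ne])
    then show "u (t *\<^sub>R x) \<le> t * u x" using t by (simp add: field_simps)
  next
    have "u 0 = (INF q\<in>C. 0)" unfolding u_def using sub sublinear_zero by (intro INF_cong) auto
    then show "u 0 = 0" using ne by simp
  qed
  then show ?thesis using le by (intro that) (auto simp: le_fun_def)
qed

text \<open>Domination will bound the charge of each ball, and equality at one prescribed vector,
  the constant function 1, will keep the total mass at least 1.\<close>

lemma Hahn_Banach_sublinear:
  fixes p :: "'v::real_vector \<Rightarrow> real"
  assumes p: "sublinear p"
  obtains L where "linear L" "\<And>x. L x \<le> p x" "L v = p v"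
proof -
  obtain p1 where p1: "sublinear p1" "\<And>x. p1 x \<le> p x" "\<And>x. p1 x \<le> p (x + v) - p v"
    using sublinear_lower_in_direction[OF p, of v] by blast
  \<comment> \<open>A minimal sublinear functional is linear, since it cannot be lowered in any direction; starting from
    \<open>p1\<close> instead of \<open>p\<close> forces \<open>L v = p v\<close>.\<close>
  define A where "A = {q. sublinear q \<and> q \<le> p1}"
  have "\<exists>m\<in>A. \<forall>a\<in>A. m \<ge> a \<longrightarrow> a = m"
  proof (rule predicate_Zorn)
    show "partial_order_on A (relation_of (\<ge>) A)"
      by (auto simp: partial_order_on_def preorder_on_def refl_on_def trans_def antisym_def relation_of_def)
    fix C assume C: "C \<in> Chains (relation_of (\<ge>) A)"
    have sub: "sublinear q \<and> q \<le> p1" if "q \<in> C" for q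
      using C that by (auto simp: Chains_def relation_of_def A_def)
    have chain: "q \<le> q' \<or> q' \<le> q" if "q \<in> C" "q' \<in> C" for q q'
      using C that by (auto simp: Chains_def relation_of_def)
    show "\<exists>u\<in>A. \<forall>a\<in>C. a \<ge> u"
    proof (cases "C = {}")
      case True
      then show ?thesis using p1 by (auto simp: A_def)
    next
      case False
      obtain u where "sublinear u" "\<And>q. q \<in> C \<Longrightarrow> u \<le> q"
        using sublinear_chain_Inf[OF False sub chain] by blast
      then show ?thesis using False sub by (auto simp: A_def intro!: bexI[of _ u]) (meson order_trans)
    qed
  qed
  then obtain L where L: "sublinear L" "L \<le> p1" and min: "\<And>q. sublinear q \<Longrightarrow> q \<le> L \<Longrightarrow> q = L"
    unfolding A_def by (metis (mono_tags, lifting) mem_Collect_eq order_trans)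
  have add: "L (x + y) = L x + L y" for x y
  proof -
    obtain q where "sublinear q" "\<And>x. q x \<le> L x" "\<And>x. q x \<le> L (x + y) - L y"
      using sublinear_lower_in_direction[OF L(1), of y] by blast
    with min[of q] have "L x \<le> L (x + y) - L y" by (auto simp: le_fun_def)
    then show ?thesis using sublinear_add[OF L(1), of x y] by simp
  qed
  have neg: "L (- x) = - L x" for x using add[of x "-x"] sublinear_zero[OF L(1)] by simp
  have "linear L"
  proof (rule linearI)
    fix t x show "L (t *\<^sub>R x) = t *\<^sub>R L x"
      using sublinear_scale[OF L(1), of t x] sublinear_scale[OF L(1), of "-t" x] neg[of "t *\<^sub>R x"]
      by (cases "0 \<le> t") auto
  qed (rule add)
  moreover have "L x \<le> p x" for x using L(2) p1(2) by (auto simp: le_fun_def intro: order_trans)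
  moreover have "L v = p v"
  proof (rule antisym)
    have "L (- v) \<le> p 0 - p v" using L(2) p1(3)[of "-v"] by (auto simp: le_fun_def intro: order_trans)
    then show "p v \<le> L v" using neg[of v] sublinear_zero[OF p] by simp
  qed fact
  ultimately show ?thesis by (rule that)
qed

section \<open>From weighted covers to charges\<close>

text \<open>Hahn--Banach is applied on the space of all bounded functions on \<open>'a\<close>, encoded as the bounded
  continuous functions on the discrete copy of \<open>'a\<close>.\<close>

lemma charge_le_weighted_cover:
  fixes B :: "'i \<Rightarrow> 'a set" and w :: "'i \<Rightarrow> real" and Z :: "'a set"
  assumes w: "\<And>i. i \<in> J \<Longrightarrow> 0 \<le> w i"
    and fin: "finite F0" "F0 \<subseteq> J" "Z \<subseteq> (\<Union>i\<in>F0. B i)"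
    and weighted: "\<And>F c. finite F \<Longrightarrow> F \<subseteq> J \<Longrightarrow> (\<And>i. i \<in> F \<Longrightarrow> 0 \<le> c i) \<Longrightarrow>
      (\<And>z. z \<in> Z \<Longrightarrow> 1 \<le> (\<Sum>i\<in>F. c i * indicator (B i) z)) \<Longrightarrow> 1 \<le> (\<Sum>i\<in>F. c i * w i)"
  obtains m :: "'a set \<Rightarrow> real" where "\<And>A. 0 \<le> m A"
    "\<And>A C. A \<inter> C = {} \<Longrightarrow> m (A \<union> C) = m A + m C"
    "m Z = 1" "m (- Z) = 0" "\<And>i. i \<in> J \<Longrightarrow> m (B i) \<le> w i"
proof -
  \<comment> \<open>\<open>S f\<close> holds the costs of the finite weighted covers that dominate
    \<open>f\<close> on \<open>Z\<close>, so \<open>p\<close> is the value of a linear programme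
    whose dual asks for a charge. The coefficients vanish outside \<open>F\<close> so that covers
    over different index sets can be added coefficientwise on \<open>F \<union> G\<close>.\<close>
  define S where "S f = {\<Sum>i\<in>F. c i * w i | F c. finite F \<and> F \<subseteq> J \<and> (\<forall>i. 0 \<le> c i) \<and> (\<forall>i. i \<notin> F \<longrightarrow> c i = 0) \<and>
    (\<forall>z\<in>Z. apply_bcontfun f (discrete z) \<le> (\<Sum>i\<in>F. c i * indicator (B i) z))}"
    for f :: "'a discrete \<Rightarrow>\<^sub>C real"
  define p where "p f = Inf (S f)" for f
  have pos: "0 \<le> y" if y: "y \<in> S f" for y f
    using y w by (auto simp: S_def intro!: sum_nonneg mult_nonneg_nonneg)
  have bdd: "bdd_below (S f)" for f using pos by (auto intro!: bdd_belowI)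
  have ne: "S f \<noteq> {}" for f
  proof -
    obtain K where K: "\<And>x. norm (apply_bcontfun f x) \<le> K" "0 < K"
      using bounded_apply_bcontfun[of f] by (auto simp: bounded_pos)
    have "apply_bcontfun f (discrete z) \<le> (\<Sum>i\<in>F0. (if i \<in> F0 then K else 0) * indicator (B i) z)" if z: "z \<in> Z" for z
    proof -
      obtain i where i: "i \<in> F0" "z \<in> B i" using fin z by blast
      have "apply_bcontfun f (discrete z) \<le> K" using K(1)[of "discrete z"] by simp
      also have "\<dots> = (if i \<in> F0 then K else 0) * indicator (B i) z" using i by simp
      also have "\<dots> \<le> (\<Sum>i\<in>F0. (if i \<in> F0 then K else 0) * indicator (B i) z)"
        using K(2) by (intro member_le_sum i fin) auto
      finally show ?thesis .
    qed
    then have "(\<Sum>i\<in>F0. (if i \<in> F0 then K else 0) * w i) \<in> S f"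
      unfolding S_def using fin K(2) by (intro CollectI exI[of _ F0] exI[of _ "\<lambda>i. if i \<in> F0 then K else 0"]) auto
    then show ?thesis by auto
  qed
  have le: "p f \<le> (\<Sum>i\<in>F. c i * w i)" if "finite F" "F \<subseteq> J" "\<And>i. 0 \<le> c i" "\<And>i. i \<notin> F \<Longrightarrow> c i = 0"
    "\<And>z. z \<in> Z \<Longrightarrow> apply_bcontfun f (discrete z) \<le> (\<Sum>i\<in>F. c i * indicator (B i) z)" for f F c
    unfolding p_def
  proof (rule cInf_lower[OF _ bdd])
    show "(\<Sum>i\<in>F. c i * w i) \<in> S f"
      unfolding S_def using that by (intro CollectI exI[of _ F] exI[of _ c]) (simp del: sum_mult_indicator)
  qed
  \<comment> \<open>The empty cover. Applied to \<open>- ind A\<close> it makes \<open>L\<close>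
    nonnegative on indicators, and applied to \<open>ind (- Z)\<close> it makes \<open>L\<close>
    vanish off \<open>Z\<close>.\<close>
  have p0: "p f \<le> 0" if "\<And>z. z \<in> Z \<Longrightarrow> apply_bcontfun f (discrete z) \<le> 0" for f
    using le[of "{}" "\<lambda>_. 0"] that by simp
  have "sublinear p"
  proof (rule sublinearI)
    fix f g
    have "p (f + g) \<le> a + b" if ab: "a \<in> S f" "b \<in> S g" for a b
    proof -
      obtain F c where F: "finite F" "F \<subseteq> J" "\<And>i. 0 \<le> c i" "\<And>i. i \<notin> F \<Longrightarrow> c i = 0" "a = (\<Sum>i\<in>F. c i * w i)"
        "\<And>z. z \<in> Z \<Longrightarrow> apply_bcontfun f (discrete z) \<le> (\<Sum>i\<in>F. c i * indicator (B i) z)"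
        using ab(1) unfolding S_def by blast
      obtain G d where G: "finite G" "G \<subseteq> J" "\<And>i. 0 \<le> d i" "\<And>i. i \<notin> G \<Longrightarrow> d i = 0" "b = (\<Sum>i\<in>G. d i * w i)"
        "\<And>z. z \<in> Z \<Longrightarrow> apply_bcontfun g (discrete z) \<le> (\<Sum>i\<in>G. d i * indicator (B i) z)"
        using ab(2) unfolding S_def by blast
      have *: "(\<Sum>i\<in>F \<union> G. (c i + d i) * h i) = (\<Sum>i\<in>F. c i * h i) + (\<Sum>i\<in>G. d i * h i)" for h :: "'i \<Rightarrow> real"
      proof -
        have "(\<Sum>i\<in>F \<union> G. c i * h i) = (\<Sum>i\<in>F. c i * h i)"
          using F G by (intro sum.mono_neutral_right) auto
        moreover have "(\<Sum>i\<in>F \<union> G. d i * h i) = (\<Sum>i\<in>G. d i * h i)"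
          using F G by (intro sum.mono_neutral_right) auto
        ultimately show ?thesis by (simp add: distrib_right sum.distrib)
      qed
      have "p (f + g) \<le> (\<Sum>i\<in>F \<union> G. (c i + d i) * w i)"
        using F G by (intro le) (auto simp: * intro!: add_mono)
      then show ?thesis using F G by (simp add: *)
    qed
    then have "p (f + g) - b \<le> p f" if "b \<in> S g" for b
      unfolding p_def[of f] using that by (intro cInf_greatest[OF ne]) (force simp: algebra_simps)
    then have "p (f + g) - p f \<le> p g"
      unfolding p_def[of g] by (intro cInf_greatest[OF ne]) (force simp: algebra_simps)
    then show "p (f + g) \<le> p f + p g" by simp
  next
    fix t :: real and f assume t: "0 < t"
    have "p (t *\<^sub>R f) / t \<le> a" if a: "a \<in> S f" for a
    proof -
      obtain F c where F: "finite F" "F \<subseteq> J" "\<And>i. 0 \<le> c i" "\<And>i. i \<notin> F \<Longrightarrow> c i = 0" "a = (\<Sum>i\<in>F. c i * w i)"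
        "\<And>z. z \<in> Z \<Longrightarrow> apply_bcontfun f (discrete z) \<le> (\<Sum>i\<in>F. c i * indicator (B i) z)"
        using a unfolding S_def by blast
      have *: "(\<Sum>i\<in>F. t * c i * h i) = t * (\<Sum>i\<in>F. c i * h i)" for h :: "'i \<Rightarrow> real"
        by (simp add: sum_distrib_left mult.assoc)
      have "p (t *\<^sub>R f) \<le> (\<Sum>i\<in>F. t * c i * w i)"
        using F t by (intro le) (auto simp: * intro!: mult_left_mono)
      then have "p (t *\<^sub>R f) \<le> t * a" unfolding * F(5) .
      then show ?thesis using t by (simp add: divide_le_eq mult.commute)
    qed
    then have "p (t *\<^sub>R f) / t \<le> p f" unfolding p_def[of f] by (intro cInf_greatest[OF ne])
    then show "p (t *\<^sub>R f) \<le> t * p f" using t by (simp add: field_simps)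
  next
    show "p 0 = 0" using p0[of 0] unfolding p_def
      using cInf_greatest[OF ne pos, of 0] by (intro antisym) auto
  qed
  define ind where "ind A = Bcontfun (\<lambda>x. indicator A (of_discrete x) :: real)" for A :: "'a set"
  have "bounded (range (\<lambda>x. indicator A (of_discrete x) :: real))" for A :: "'a set"
    by (rule boundedI[of _ 1]) (auto simp: indicator_def)
  then have "(\<lambda>x. indicator A (of_discrete x) :: real) \<in> bcontfun" for A :: "'a set"
    by (simp add: bcontfun_def continuous_on_open_invariant open_discrete)
  then have ind: "apply_bcontfun (ind A) x = indicator A (of_discrete x)" for A x
    unfolding ind_def by (simp add: Bcontfun_inverse)
  obtain L where L: "linear L" "\<And>x. L x \<le> p x" "L (ind UNIV) = p (ind UNIV)"
    using Hahn_Banach_sublinear[OF \<open>sublinear p\<close>, of "ind UNIV"] by blast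
  \<comment> \<open>\<open>L\<close> agrees with \<open>p\<close> at \<open>ind UNIV\<close>, and
    \<open>weighted\<close> says that covering the constant 1 on \<open>Z\<close> costs at least
    1.\<close>
  have one: "1 \<le> L (ind UNIV)"
    unfolding L p_def
  proof (rule cInf_greatest[OF ne])
    fix y assume "y \<in> S (ind UNIV)"
    then show "1 \<le> y" unfolding S_def using weighted by (auto simp: ind discrete_inverse)
  qed
  have nonneg: "0 \<le> L (ind A)" for A
    using L(2)[of "- ind A"] p0[of "- ind A"] linear_neg[OF L(1), of "ind A"] by (simp add: ind)
  have add: "L (ind (A \<union> C)) = L (ind A) + L (ind C)" if "A \<inter> C = {}" for A C
  proof -
    have "ind (A \<union> C) = ind A + ind C"
      using that by (intro bcontfun_eqI) (auto simp: ind indicator_def)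
    then show ?thesis by (simp add: linear_add[OF L(1)])
  qed
  have "L (ind (- Z)) \<le> 0"
    using L(2)[of "ind (- Z)"] p0[of "ind (- Z)"] by (simp add: ind discrete_inverse)
  then have cZ: "L (ind (- Z)) = 0" using nonneg by (simp add: antisym)
  have LB: "L (ind (B i)) \<le> w i" if "i \<in> J" for i
  proof -
    have "p (ind (B i)) \<le> (\<Sum>j\<in>{i}. (if j = i then 1 else 0) * w j)"
      using that by (intro le) (auto simp: ind discrete_inverse)
    then show ?thesis using L(2)[of "ind (B i)"] by simp
  qed
  \<comment> \<open>The divisor is at least 1, so normalizing the mass only lowers the values on the
    sets \<open>B i\<close>.\<close>
  define m where "m A = L (ind A) / L (ind UNIV)" for A
  show thesis
  proof (rule that[of m])
    show "0 \<le> m A" for A using one nonneg by (simp add: m_def)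
    show "m (A \<union> C) = m A + m C" if "A \<inter> C = {}" for A C
      using add[OF that] by (simp add: m_def add_divide_distrib)
    show "m (- Z) = 0" by (simp add: m_def cZ)
    have "L (ind UNIV) = L (ind Z)" using add[of Z "-Z"] cZ by (simp add: Un_commute)
    then show "m Z = 1" using one by (simp add: m_def)
    show "m (B i) \<le> w i" if "i \<in> J" for i
      using LB[OF that] one w[OF that] mult_left_mono[OF one w[OF that]] by (simp add: m_def divide_le_eq)
  qed
qed

section \<open>From charges to Borel measures\<close>

text \<open>The layers are disjoint and consecutive, so finite additivity telescopes their charges.
  Bounded partial sums are the substitute for countable additivity, which \<open>m\<close> may
  lack.\<close>

lemma sum_charge_layers_le:
  fixes m :: "'a set \<Rightarrow> real" and d :: "'a \<Rightarrow> real" and a :: "nat \<Rightarrow> real"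
  assumes nonneg: "\<And>A. 0 \<le> m A"
    and add: "\<And>A C. A \<inter> C = {} \<Longrightarrow> m (A \<union> C) = m A + m C"
    and a: "decseq a"
  shows "(\<Sum>j<n. m {x. a (Suc j) < d x \<and> d x \<le> a j}) \<le> m UNIV"
proof -
  have e: "m {} = 0" using add[of "{}" "{}"] by simp
  have "(\<Sum>j<n. m {x. a (Suc j) < d x \<and> d x \<le> a j}) = m {x. a n < d x \<and> d x \<le> a 0}"
  proof (induction n)
    case (Suc n)
    have "a (Suc n) \<le> a n" "a n \<le> a 0" using a by (auto simp: decseq_def)
    then have "{x. a (Suc n) < d x \<and> d x \<le> a 0} =
        {x. a n < d x \<and> d x \<le> a 0} \<union> {x. a (Suc n) < d x \<and> d x \<le> a n}" by auto
    then show ?case using Suc by (simp add: add[of "{x. a n < d x \<and> d x \<le> a 0}"] disjoint_iff)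
  qed (auto simp: e not_le[symmetric])
  also have "\<dots> \<le> m UNIV"
    using add[of "{x. a n < d x \<and> d x \<le> a 0}" "- {x. a n < d x \<and> d x \<le> a 0}"]
      nonneg[of "- {x. a n < d x \<and> d x \<le> a 0}"] by (simp del: Compl_iff)
  finally show ?thesis .
qed

text \<open>The charge need not be countably additive and can exceed the measure even on open sets,
  so the bound is one-sided. Caratheodory's criterion for a closed set is first proved with open
  test sets (\<open>split_open\<close>); covers carry it over to all test sets
  (\<open>closed_meas\<close>), and the closed sets generate the Borel sets.\<close>

lemma borel_measure_le_charge:
  fixes m :: "'a::metric_space set \<Rightarrow> real" and Z :: "'a set"
  assumes nonneg: "\<And>A. 0 \<le> m A"
    and add: "\<And>A C. A \<inter> C = {} \<Longrightarrow> m (A \<union> C) = m A + m C"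
    and Z: "compact Z" "m Z = 1" "m (- Z) = 0"
  obtains \<mu> where "\<mu> \<in> probs_on Z" "\<And>U. open U \<Longrightarrow> emeasure \<mu> U \<le> ennreal (m U)"
proof -
  have me: "m {} = 0" using add[of "{}" "{}"] by simp
  have mono: "m A \<le> m C" if AC: "A \<subseteq> C" for A C
  proof -
    have "A \<union> (C - A) = C" using AC by blast
    then show ?thesis using add[of A "C - A"] nonneg[of "C - A"] by simp
  qed
  have sub: "m (A \<union> C) \<le> m A + m C" for A C
    using add[of A "C - A"] mono[of "C - A" C] by simp
  have mUN: "m (\<Union>i\<in>I. A i) \<le> (\<Sum>i\<in>I. m (A i))" if "finite I" for I :: "nat set" and A
    using that by induction (auto simp: me intro: order_trans[OF sub])
  have mUNIV: "m UNIV = 1" using add[of Z "- Z"] Z by simp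

  define S where "S A = {\<Sum>i. ennreal (m (U i)) | U :: nat \<Rightarrow> 'a set. (\<forall>i. open (U i)) \<and> A \<subseteq> (\<Union>i. U i)}" for A
  define f where "f A = Inf (S A)" for A
  have f_le: "f A \<le> (\<Sum>i. ennreal (m (U i)))" if "\<And>i. open (U i)" "A \<subseteq> (\<Union>i. U i)" for A U
    unfolding f_def S_def using that by (intro Inf_lower) blast
  have f_open: "f U \<le> ennreal (m U)" if "open U" for U
  proof -
    have "f U \<le> (\<Sum>i. ennreal (m (if i = 0 then U else {})))"
      using that by (intro f_le) auto
    also have "\<dots> = (\<Sum>i\<in>{0::nat}. ennreal (m (if i = 0 then U else {})))"
      by (intro suminf_finite) (auto simp: me)
    finally show ?thesis by simp
  qed
  have f_mono: "f A \<le> f C" if AC: "A \<subseteq> C" for A C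
    unfolding f_def S_def by (rule Inf_superset_mono) (use AC in blast)
  have fe: "f {} = 0" using f_open[of "{}"] me by simp
  have f_sub: "f (\<Union>i. A i) \<le> (\<Sum>i. f (A i))" for A :: "nat \<Rightarrow> 'a set"
  proof (rule ennreal_le_epsilon)
    fix e :: real assume "0 < e" "(\<Sum>n. f (A n)) < top"
    then have *: "f (A n) < f (A n) + e * (1/2)^Suc n" for n
      by (auto simp add: less_top dest!: ennreal_suminf_lessD)
    have "\<exists>U. (\<forall>i. open (U i)) \<and> A n \<subseteq> (\<Union>i. U i) \<and> (\<Sum>i. ennreal (m (U i))) \<le> f (A n) + e * (1/2)^Suc n" for n
    proof -
      obtain y where "y \<in> S (A n)" "y < f (A n) + e * (1/2)^Suc n"
        using *[of n] unfolding f_def Inf_less_iff by blast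
      then show ?thesis unfolding S_def by (auto intro: less_imp_le)
    qed
    then obtain B where B: "\<And>n i. open (B n i)" "\<And>n. A n \<subseteq> (\<Union>i. B n i)"
      "\<And>n. (\<Sum>i. ennreal (m (B n i))) \<le> f (A n) + e * (1/2)^Suc n" by metis
    define C where "C k = (case prod_decode k of (n, i) \<Rightarrow> B n i)" for k
    have "f (\<Union>i. A i) \<le> (\<Sum>k. ennreal (m (C k)))"
    proof (rule f_le)
      show "(\<Union>i. A i) \<subseteq> (\<Union>k. C k)"
        using B(2) by (auto simp add: C_def subset_eq) (metis prod.case prod_encode_inverse)
    qed (auto simp: C_def B split: prod.split)
    also have "\<dots> = (\<Sum>n. \<Sum>i. ennreal (m (B n i)))"
      unfolding C_def
      by (subst suminf_ennreal_2dimen[where f = "\<lambda>(n, i). ennreal (m (B n i))", symmetric])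
         (auto split: prod.split intro!: suminf_cong)
    also have "\<dots> \<le> (\<Sum>n. f (A n) + e * (1/2) ^ Suc n)"
      by (intro suminf_le B) auto
    also have "\<dots> = (\<Sum>n. f (A n)) + (\<Sum>n. ennreal e * ennreal ((1/2) ^ Suc n))"
      using \<open>0 < e\<close> by (subst suminf_add[symmetric])
        (auto simp del: ennreal_suminf_cmult simp add: ennreal_mult[symmetric])
    also have "\<dots> = (\<Sum>n. f (A n)) + e"
      unfolding ennreal_suminf_cmult
      by (subst suminf_ennreal_eq[OF zero_le_power power_half_series]) auto
    finally show "f (\<Union>i. A i) \<le> (\<Sum>n. f (A n)) + e" .
  qed
  have f_sub2: "f (A \<union> C) \<le> f A + f C" for A C
    using f_sub[of "binaryset A C"] suminf_binaryset_eq[of f A C] fe by (simp add: UN_binaryset_eq)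

  \<comment> \<open>The open set \<open>V = U - C\<close> is exhausted by the sets \<open>Vk\<close> at positive distance from its complement; the rings
    \<open>R j\<close> between them overlap at most twice, so their charges are summable and the tail is negligible.\<close>
  have split_open: "f (U \<inter> C) + f (U - C) \<le> ennreal (m U)" if U: "open U" and C: "closed C" for U C
  proof (cases "U \<inter> C = {}")
    case True
    then show ?thesis using f_open[OF U] fe by (simp add: Diff_triv)
  next
    case ne: False
    define V where "V = U - C"
    have V: "open V" unfolding V_def using U C by (rule open_Diff)
    define d where "d x = infdist x (- V)" for x
    have neV: "- V \<noteq> {}" using ne by (auto simp: V_def)
    have d_pos: "0 < d x \<longleftrightarrow> x \<in> V" for x
      using in_closed_iff_infdist_zero[of "- V" x] V neV infdist_nonneg[of x "- V"]
      by (auto simp: d_def less_le)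
    have cont: "continuous_on UNIV d" unfolding d_def by (intro continuous_intros)
    define a where "a j = 1 / (real j + 1)" for j
    have a_pos: "0 < a j" for j by (simp add: a_def)
    have a_dec: "decseq a" unfolding a_def by (intro decseq_SucI) (simp add: frac_le)
    \<comment> \<open>Two versions of the same rings: \<open>R j\<close> is open, as the covers in
      \<open>f\<close> require, and the half-open \<open>H j\<close> are disjoint, as
      \<open>sum_charge_layers_le\<close> requires. Each \<open>R j\<close> lies in the union of
      \<open>H j\<close> and \<open>H (Suc j)\<close>.\<close>
    define R where "R j = {x. a (j + 2) < d x \<and> d x < a j}" for j
    define H where "H j = {x. a (Suc j) < d x \<and> d x \<le> a j}" for j
    have R_open: "open (R j)" for j
      unfolding R_def by (intro open_Collect_conj open_Collect_less continuous_intros cont)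
    have RH: "m (R j) \<le> m (H j) + m (H (Suc j))" for j
    proof -
      have "R j \<subseteq> H j \<union> H (Suc j)" by (auto simp: R_def H_def)
      then show ?thesis using mono sub order_trans by blast
    qed
    have Hsum: "(\<Sum>j<n. m (H j)) \<le> 1" for n
      unfolding H_def using sum_charge_layers_le[where m=m and d=d, OF nonneg add a_dec] mUNIV by simp
    have Rsum: "summable (\<lambda>j. m (R j))"
    proof (rule summableI_nonneg_bounded[OF nonneg])
      fix n
      have "(\<Sum>j<n. m (R j)) \<le> (\<Sum>j<n. m (H j)) + (\<Sum>j<n. m (H (Suc j)))"
        unfolding sum.distrib[symmetric] by (intro sum_mono RH)
      also have "(\<Sum>j<n. m (H (Suc j))) \<le> (\<Sum>j<Suc n. m (H j))"
        unfolding sum.lessThan_Suc_shift[of _ n] using nonneg by simp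
      finally show "(\<Sum>j<n. m (R j)) \<le> 2" using Hsum[of n] Hsum[of "Suc n"] by linarith
    qed
    show ?thesis
    proof (rule ennreal_le_epsilon)
      fix e :: real assume e: "0 < e"
      obtain k where k: "norm (\<Sum>j. m (R (j + k))) < e"
        using suminf_exist_split[OF e Rsum] by blast
      define Vk where "Vk = {x. a (Suc k) < d x}"
      \<comment> \<open>\<open>W\<close> is an open neighbourhood of \<open>U \<inter> C\<close>
        that misses \<open>Vk\<close>, and both lie in \<open>U\<close>, so finite additivity gives
        \<open>m W + m Vk \<le> m U\<close>.\<close>
      define W where "W = U \<inter> {x. d x < a (Suc k)}"
      have Vk_open: "open Vk" unfolding Vk_def by (intro open_Collect_less continuous_intros cont)
      have W_open: "open W" unfolding W_def by (intro open_Int U open_Collect_less continuous_intros cont)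
      define Q where "Q i = (case i of 0 \<Rightarrow> Vk | Suc j \<Rightarrow> R (j + k))" for i
      have "V \<subseteq> (\<Union>i. Q i)"
      proof
        fix x assume x: "x \<in> V"
        show "x \<in> (\<Union>i. Q i)"
        proof (cases "a (Suc k) < d x")
          case True
          then have "x \<in> Q 0" by (simp add: Q_def Vk_def)
          then show ?thesis by blast
        next
          case False
          have "a \<longlonglongrightarrow> 0" unfolding a_def using LIMSEQ_inverse_real_of_nat by (simp add: inverse_eq_divide add.commute)
          then have "\<exists>n. a n < d x"
            using x d_pos[of x] by (metis order_tendstoD(2) eventually_sequentially order_refl)
          \<comment> \<open>With \<open>n\<close> minimal, \<open>a n < d x \<le> a (n - 1)\<close>,
            and \<open>n\<close> is at least \<open>k + 2\<close>. This puts \<open>x\<close> in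
            \<open>R (n - 2)\<close>, while the rings in \<open>Q\<close> start at index
            \<open>k\<close>.\<close>
          then obtain n where n: "a n < d x" "\<And>i. i < n \<Longrightarrow> d x \<le> a i"
            using exists_least_iff[of "\<lambda>n. a n < d x"] by (auto simp: not_less)
          have "\<not> n \<le> Suc k"
          proof
            assume "n \<le> Suc k"
            then have "a (Suc k) \<le> a n" using a_dec by (auto simp: decseq_def)
            then show False using False n by simp
          qed
          then obtain j where j: "n = j + k + 2" by (metis add.commute add_2_eq_Suc' less_iff_Suc_add not_le add_Suc)
          have "d x \<le> a (Suc (j + k))" using n(2) j by simp
          also have "\<dots> < a (j + k)" by (simp add: a_def frac_less2)
          finally have "x \<in> Q (Suc j)" using n(1) j by (simp add: Q_def R_def)
          then show ?thesis by blast
        qed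
      qed
      then have "f V \<le> (\<Sum>i. ennreal (m (Q i)))"
        using Vk_open R_open by (intro f_le) (auto simp: Q_def split: nat.split)
      also have "\<dots> = ennreal (m Vk + (\<Sum>j. m (R (j + k))))"
      proof -
        have "summable (\<lambda>j. m (Q (Suc j)))" using summable_ignore_initial_segment[OF Rsum] by (simp add: Q_def)
        then have Qsum: "summable (\<lambda>i. m (Q i))" by (rule summable_Suc_iff[THEN iffD1])
        have "(\<Sum>i. ennreal (m (Q i))) = ennreal (\<Sum>i. m (Q i))"
          by (rule suminf_ennreal2[OF nonneg Qsum])
        also have "(\<Sum>i. m (Q i)) = m (Q 0) + (\<Sum>j. m (Q (Suc j)))" using suminf_split_head[OF Qsum] by simp
        finally show ?thesis by (simp add: Q_def)
      qed
      also have "\<dots> \<le> ennreal (m Vk + e)" using k by (intro ennreal_leI) auto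
      finally have fV: "f V \<le> ennreal (m Vk) + ennreal e" using nonneg e by simp
      have "U \<inter> C \<subseteq> W"
      proof
        fix x assume x: "x \<in> U \<inter> C"
        then have "\<not> 0 < d x" unfolding d_pos by (simp add: V_def)
        then show "x \<in> W" using x a_pos[of "Suc k"] by (simp add: W_def)
      qed
      then have "f (U \<inter> C) \<le> ennreal (m W)" using f_mono f_open[OF W_open] order_trans by blast
      then have "f (U \<inter> C) + f V \<le> ennreal (m W) + (ennreal (m Vk) + ennreal e)"
        using fV by (rule add_mono)
      also have "\<dots> = ennreal (m W + m Vk) + ennreal e" using nonneg e by (simp add: add.assoc)
      also have "m W + m Vk = m (W \<union> Vk)" by (rule add[symmetric]) (auto simp: W_def Vk_def)
      also have "ennreal (m (W \<union> Vk)) \<le> ennreal (m U)"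
      proof (intro ennreal_leI mono)
        have "Vk \<subseteq> V" using a_pos[of "Suc k"] by (auto simp: Vk_def d_pos[symmetric])
        then show "W \<union> Vk \<subseteq> U" by (auto simp: W_def V_def)
      qed
      finally show "f (U \<inter> C) + f (U - C) \<le> ennreal (m U) + ennreal e"
        by (simp add: V_def add_right_mono)
    qed
  qed
  have closed_meas: "f (A \<inter> C) + f (A - C) = f A" if C: "closed C" for A C
  proof (rule antisym)
    show "f (A \<inter> C) + f (A - C) \<le> f A" unfolding f_def[of A]
    proof (rule Inf_greatest)
      fix y assume "y \<in> S A"
      then obtain U where U: "\<And>i. open (U i)" "A \<subseteq> (\<Union>i. U i)" and y: "y = (\<Sum>i. ennreal (m (U i)))"
        by (auto simp: S_def)
      have "f (A \<inter> C) \<le> f (\<Union>i. U i \<inter> C)" "f (A - C) \<le> f (\<Union>i. U i - C)"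
        using U(2) by (auto intro!: f_mono)
      then have "f (A \<inter> C) + f (A - C) \<le> (\<Sum>i. f (U i \<inter> C)) + (\<Sum>i. f (U i - C))"
        by (intro add_mono order_trans[OF _ f_sub])
      also have "\<dots> = (\<Sum>i. f (U i \<inter> C) + f (U i - C))" by (rule suminf_add) auto
      also have "\<dots> \<le> y" unfolding y by (intro suminf_le split_open U C) auto
      finally show "f (A \<inter> C) + f (A - C) \<le> y" .
    qed
    show "f A \<le> f (A \<inter> C) + f (A - C)" using f_sub2[of "A \<inter> C" "A - C"] by (simp add: Int_Diff_Un)
  qed

  interpret P: sigma_algebra UNIV "Pow UNIV :: 'a set set" by (rule sigma_algebra_Pow)
  define L where "L = lambda_system UNIV (Pow UNIV) f"
  have "outer_measure_space (Pow UNIV) f"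
    using fe f_mono f_sub
    by (auto simp: outer_measure_space_def positive_def increasing_def countably_subadditive_def)
  then have Lm: "measure_space UNIV L f" unfolding L_def by (rule P.caratheodory_lemma)
  then have L_sa: "sigma_algebra UNIV L" by (simp add: measure_space_def)
  have "{C. closed C} \<subseteq> L" unfolding L_def P.lambda_system_eq using closed_meas by auto
  then have "sets (borel :: 'a measure) \<subseteq> L"
    unfolding borel_eq_closed using sigma_algebra.sigma_sets_subset[OF L_sa] by simp
  then have ms: "measure_space UNIV (sets borel) f"
    using sets.sigma_algebra_axioms[of "borel :: 'a measure"] by (intro measure_down[OF Lm]) auto
  define \<mu> where "\<mu> = measure_of UNIV (sets borel) f"
  have sets: "sets \<mu> = sets borel" unfolding \<mu>_def
    using sets.sets_measure_of_eq[of "borel :: 'a measure"] by simp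
  have em: "emeasure \<mu> A = f A" if "A \<in> sets borel" for A
    unfolding \<mu>_def using ms that by (intro emeasure_measure_of_sigma) (auto simp: measure_space_def)
  \<comment> \<open>The charge is known to be subadditive over finite unions only, so the countable
    cover is cut down to a finite one before charges are compared.\<close>
  have fZ: "1 \<le> f Z" unfolding f_def
  proof (rule Inf_greatest)
    fix y assume "y \<in> S Z"
    then obtain U where U: "\<And>i. open (U i)" "Z \<subseteq> (\<Union>i. U i)" and y: "y = (\<Sum>i. ennreal (m (U i)))"
      by (auto simp: S_def)
    obtain I where I: "finite I" "Z \<subseteq> (\<Union>i\<in>I. U i)"
      using compactE_image[OF Z(1), of UNIV U] U by auto
    have "1 \<le> (\<Sum>i\<in>I. m (U i))" using mono[OF I(2)] mUN[OF I(1), of U] Z by linarith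
    then have "1 \<le> (\<Sum>i\<in>I. ennreal (m (U i)))" by (simp add: nonneg)
    also have "\<dots> \<le> y" unfolding y by (intro sum_le_suminf I) auto
    finally show "1 \<le> y" .
  qed
  have fU: "f UNIV \<le> 1" using f_open[of UNIV] mUNIV by simp
  have space: "space \<mu> = UNIV" using sets_eq_imp_space_eq[OF sets] by simp
  have "emeasure \<mu> UNIV = 1" "emeasure \<mu> Z = 1"
    using fU fZ f_mono[of Z UNIV] em[of Z] em[of UNIV] compact_imp_closed[OF Z(1)] by auto
  then have "\<mu> \<in> probs_on Z" using sets space by (auto simp: probs_on_def intro!: prob_spaceI)
  moreover have "emeasure \<mu> U \<le> ennreal (m U)" if "open U" for U
    using f_open[OF that] em[of U] that by simp
  ultimately show thesis by (rule that)
qed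

section \<open>Integrals and logarithms in the extended reals\<close>

text \<open>Monotonicity of \<open>nn_integral\<close> holds for arbitrary functions. The sign of
  \<open>c\<close> decides which part carries the bound: for \<open>c \<ge> 0\<close> the negative
  part vanishes, and for \<open>c < 0\<close> its integral is at most \<open>- c\<close>, so the
  difference never becomes infinity minus infinity.\<close>

lemma ereal_integral_ge:
  assumes "prob_space \<mu>" and "\<And>x. x \<in> space \<mu> \<Longrightarrow> ereal c \<le> f x"
  shows "ereal c \<le> ereal_integral \<mu> f"
proof -
  interpret prob_space \<mu> by fact
  show ?thesis
  proof (cases "0 \<le> c")
    case True
    have "(\<integral>\<^sup>+ x. ennreal c \<partial>\<mu>) \<le> (\<integral>\<^sup>+ x. e2ennreal (f x) \<partial>\<mu>)"
      using assms(2) True by (intro nn_integral_mono) (metis e2ennreal_ereal e2ennreal_mono)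
    then have "ennreal c \<le> (\<integral>\<^sup>+ x. e2ennreal (f x) \<partial>\<mu>)" by (simp add: emeasure_space_1)
    then have 1: "ereal c \<le> enn2ereal (\<integral>\<^sup>+ x. e2ennreal (f x) \<partial>\<mu>)"
      using True by (metis enn2ereal_ennreal less_eq_ennreal.rep_eq)
    have "(\<integral>\<^sup>+ x. e2ennreal (- f x) \<partial>\<mu>) \<le> (\<integral>\<^sup>+ x. 0 \<partial>\<mu>)"
    proof (rule nn_integral_mono)
      fix x assume "x \<in> space \<mu>"
      then have "ereal 0 \<le> f x" using assms(2)[of x] True by (meson ereal_less_eq(3) order_trans)
      then have "- f x \<le> 0" using ereal_uminus_le_0_iff by (simp add: zero_ereal_def)
      then show "e2ennreal (- f x) \<le> 0" by (simp add: e2ennreal_neg)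
    qed
    then have "enn2ereal (\<integral>\<^sup>+ x. e2ennreal (- f x) \<partial>\<mu>) = 0" by (simp add: zero_ennreal.rep_eq)
    then show ?thesis using 1 by (simp add: ereal_integral_def)
  next
    case False
    have "(\<integral>\<^sup>+ x. e2ennreal (- f x) \<partial>\<mu>) \<le> (\<integral>\<^sup>+ x. ennreal (- c) \<partial>\<mu>)"
    proof (rule nn_integral_mono)
      fix x assume "x \<in> space \<mu>"
      then have "- f x \<le> ereal (- c)" using assms(2)[of x] ereal_minus_le_minus by (metis uminus_ereal.simps(1))
      then show "e2ennreal (- f x) \<le> ennreal (- c)" by (metis e2ennreal_ereal e2ennreal_mono)
    qed
    then have "(\<integral>\<^sup>+ x. e2ennreal (- f x) \<partial>\<mu>) \<le> ennreal (- c)" by (simp add: emeasure_space_1)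
    then have "enn2ereal (\<integral>\<^sup>+ x. e2ennreal (- f x) \<partial>\<mu>) \<le> ereal (- c)"
      using False by (metis enn2ereal_ennreal less_eq_ennreal.rep_eq linorder_linear neg_0_le_iff_le)
    then have "0 - ereal (- c) \<le> ereal_integral \<mu> f"
      unfolding ereal_integral_def by (intro ereal_minus_mono) auto
    then show ?thesis by simp
  qed
qed

text \<open>For \<open>c \<ge> 0\<close> the positive part integrates to at most \<open>c\<close>;
  for \<open>c < 0\<close> it vanishes almost everywhere and the negative part integrates to at
  least \<open>- c\<close>.\<close>

lemma ereal_integral_le_AE:
  assumes "prob_space \<mu>" and le: "AE x in \<mu>. f x \<le> ereal c"
  shows "ereal_integral \<mu> f \<le> ereal c"
proof -
  interpret prob_space \<mu> by fact
  show ?thesis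
  proof (cases "0 \<le> c")
    case True
    have "AE x in \<mu>. e2ennreal (f x) \<le> ennreal c"
      using le by eventually_elim (metis e2ennreal_ereal e2ennreal_mono)
    then have "(\<integral>\<^sup>+ x. e2ennreal (f x) \<partial>\<mu>) \<le> (\<integral>\<^sup>+ x. ennreal c \<partial>\<mu>)"
      by (rule nn_integral_mono_AE)
    then have "(\<integral>\<^sup>+ x. e2ennreal (f x) \<partial>\<mu>) \<le> ennreal c" by (simp add: emeasure_space_1)
    then have "enn2ereal (\<integral>\<^sup>+ x. e2ennreal (f x) \<partial>\<mu>) \<le> ereal c"
      using True by (metis enn2ereal_ennreal less_eq_ennreal.rep_eq)
    then have "ereal_integral \<mu> f \<le> ereal c - 0"
      unfolding ereal_integral_def by (intro ereal_minus_mono) auto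
    then show ?thesis by simp
  next
    case False
    have "AE x in \<mu>. e2ennreal (f x) \<le> 0"
    proof (use le in eventually_elim)
      fix x assume "f x \<le> ereal c"
      then have "f x \<le> 0" using False by (metis ereal_less_eq(3) linorder_linear order_trans zero_ereal_def)
      then show "e2ennreal (f x) \<le> 0" by (simp add: e2ennreal_neg)
    qed
    then have "(\<integral>\<^sup>+ x. e2ennreal (f x) \<partial>\<mu>) \<le> (\<integral>\<^sup>+ x. 0 \<partial>\<mu>)"
      by (rule nn_integral_mono_AE)
    then have 1: "enn2ereal (\<integral>\<^sup>+ x. e2ennreal (f x) \<partial>\<mu>) \<le> 0" by (simp add: zero_ennreal.rep_eq)
    have "AE x in \<mu>. ennreal (- c) \<le> e2ennreal (- f x)"
    proof (use le in eventually_elim)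
      fix x assume "f x \<le> ereal c"
      then have "ereal (- c) \<le> - f x" using ereal_minus_le_minus by (metis uminus_ereal.simps(1))
      then show "ennreal (- c) \<le> e2ennreal (- f x)" by (metis e2ennreal_ereal e2ennreal_mono)
    qed
    then have "(\<integral>\<^sup>+ x. ennreal (- c) \<partial>\<mu>) \<le> (\<integral>\<^sup>+ x. e2ennreal (- f x) \<partial>\<mu>)"
      by (rule nn_integral_mono_AE)
    then have "ennreal (- c) \<le> (\<integral>\<^sup>+ x. e2ennreal (- f x) \<partial>\<mu>)" by (simp add: emeasure_space_1)
    then have "ereal (- c) \<le> enn2ereal (\<integral>\<^sup>+ x. e2ennreal (- f x) \<partial>\<mu>)"
      using False by (metis enn2ereal_ennreal less_eq_ennreal.rep_eq linorder_linear neg_0_le_iff_le)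
    then have "ereal_integral \<mu> f \<le> 0 - ereal (- c)"
      unfolding ereal_integral_def using 1 by (intro ereal_minus_mono) auto
    then show ?thesis by simp
  qed
qed

lemma neglog_ge:
  assumes "a \<le> ennreal (exp r)"
  shows "ereal (- r) \<le> neglog a"
proof (cases "a = 0")
  case False
  obtain x where x: "a = ennreal x" "0 \<le> x" "x \<le> exp r"
    using assms by (cases a) (auto simp: top_unique)
  then have "0 < x" using False by (cases "x = 0") auto
  then have "ln x \<le> r" using x by (metis ln_exp ln_le_cancel_iff exp_gt_zero)
  then show ?thesis using x False by (simp add: neglog_def)
qed (simp add: neglog_def)

lemma le_exp_of_neglog_gt:
  assumes "a < top" "ereal (- r) < neglog a"
  shows "a \<le> ennreal (exp r)"
proof (cases "a = 0")
  case False
  obtain x where x: "a = ennreal x" "0 \<le> x"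
    using assms(1) by (cases a) auto
  then have "0 < x" using False by (cases "x = 0") auto
  moreover have "ln x < r" using x False assms(2) by (simp add: neglog_def)
  ultimately have "x \<le> exp r" by (metis exp_less_mono exp_ln less_imp_le)
  then show ?thesis using x by (simp add: ennreal_leI)
qed simp

section \<open>Weighted covers by neutralized Bowen balls\<close>

text \<open>Greedy selection. Any two points of a \<open>B i\<close> are related, so a point chosen
  in \<open>B i\<close> disposes of all of \<open>B i\<close>, and the selection stops after at most
  as many choices as there are sets in the cover.\<close>

lemma finite_separated_net:
  assumes "finite I" "A \<subseteq> (\<Union>i\<in>I. B i)"
    and "\<And>i x y. i \<in> I \<Longrightarrow> x \<in> B i \<Longrightarrow> y \<in> B i \<Longrightarrow> R x y"
    and sym: "\<And>x y. R x y \<Longrightarrow> R y x"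
  obtains E where "finite E" "E \<subseteq> A" "pairwise (\<lambda>x y. \<not> R x y) E" "\<And>y. y \<in> A \<Longrightarrow> \<exists>x\<in>E. R x y"
proof -
  have "\<exists>E. finite E \<and> E \<subseteq> A \<and> pairwise (\<lambda>x y. \<not> R x y) E \<and> (\<forall>y\<in>A. \<exists>x\<in>E. R x y)"
    using assms(1-3)
  proof (induction I arbitrary: A rule: finite_induct)
    case empty
    then show ?case by auto
  next
    case (insert i I)
    show ?case
    proof (cases "A \<inter> B i = {}")
      case True
      have "A \<subseteq> (\<Union>j\<in>I. B j)" using insert.prems(1) True by auto
      then show ?thesis by (rule insert.IH) (rule insert.prems(2); simp)
    next
      case False
      then obtain x where x: "x \<in> A" "x \<in> B i" by blast
      have "\<exists>E. finite E \<and> E \<subseteq> {y \<in> A. \<not> R x y} \<and> pairwise (\<lambda>x y. \<not> R x y) E \<and>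
          (\<forall>y\<in>{y \<in> A. \<not> R x y}. \<exists>x\<in>E. R x y)"
      proof (rule insert.IH)
        show "{y \<in> A. \<not> R x y} \<subseteq> (\<Union>j\<in>I. B j)"
          using insert.prems(1) insert.prems(2)[of i x] x by auto
      qed (use insert.prems in auto)
      then obtain E where "finite E" "E \<subseteq> {y \<in> A. \<not> R x y}" "pairwise (\<lambda>x y. \<not> R x y) E"
        "\<forall>y\<in>{y \<in> A. \<not> R x y}. \<exists>x\<in>E. R x y" by blast
      then show ?thesis using x sym
        by (intro exI[of _ "insert x E"]) (auto simp: pairwise_insert)
    qed
  qed
  then show ?thesis using that by blast
qed

section \<open>Neutralized Bowen balls and distortion in a compact system\<close>

locale compact_system =
  fixes T :: "'a::metric_space \<Rightarrow> 'a" and phi :: "nat \<Rightarrow> 'a \<Rightarrow> real"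
  assumes compact_UNIV: "compact (UNIV :: 'a set)"
    and continuous_T: "continuous_on UNIV T"
    and continuous_phi: "\<And>n. continuous_on UNIV (phi n)"
begin

lemma continuous_funpow: "continuous_on UNIV (T ^^ j)"
proof (induction j)
  case (Suc j)
  then show ?case using continuous_on_compose[of UNIV "T ^^ j" T] continuous_T
    by (auto intro: continuous_on_subset)
qed (simp add: id_def)

lemma open_nball: "open (nball T n x eps)"
proof -
  have "nball T n x eps = (\<Inter>j\<in>{..<n}. {y. dist ((T ^^ j) x) ((T ^^ j) y) < exp (- real n * eps)})"
    by (auto simp: nball_def bowen_ball_def)
  then show ?thesis
    by (auto intro!: open_INT open_Collect_less continuous_intros continuous_funpow)
qed

lemma center_in_nball: "x \<in> nball T n x eps"
  by (simp add: nball_def bowen_ball_def)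

lemma nball_sym: "y \<in> nball T n x eps \<longleftrightarrow> x \<in> nball T n y eps"
  by (simp add: nball_def bowen_ball_def dist_commute)

lemma nball_antimono: "eps1 \<le> eps2 \<Longrightarrow> nball T n x eps2 \<subseteq> nball T n x eps1"
  by (auto simp: nball_def bowen_ball_def mult_left_mono intro: less_le_trans)

text \<open>The triangle inequality costs a factor 2, and
  \<open>2 * exp (- 2 * n * eps) \<le> exp (- n * eps)\<close> holds exactly when
  \<open>ln 2 \<le> n * eps\<close>.\<close>

lemma nball_double:
  assumes "ln 2 \<le> real n * eps" "x \<in> nball T n z (2 * eps)" "y \<in> nball T n z (2 * eps)"
  shows "y \<in> nball T n x eps"
proof -
  have "2 * exp (- real n * (2 * eps)) = exp (ln 2 - real n * (2 * eps))"
    by (simp add: exp_diff exp_minus field_simps)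
  also have "\<dots> \<le> exp (- real n * eps)" using assms(1) by (simp add: mult.commute)
  finally have r: "2 * exp (- real n * (2 * eps)) \<le> exp (- real n * eps)" .
  have "dist ((T ^^ j) x) ((T ^^ j) y) < exp (- real n * eps)" if "j < n" for j
  proof -
    have "dist ((T ^^ j) z) ((T ^^ j) x) < exp (- real n * (2 * eps))"
      "dist ((T ^^ j) z) ((T ^^ j) y) < exp (- real n * (2 * eps))"
      using assms that by (auto simp: nball_def bowen_ball_def)
    then show ?thesis using r dist_triangle3[of "(T ^^ j) x" "(T ^^ j) y" "(T ^^ j) z"] by linarith
  qed
  then show ?thesis by (simp add: nball_def bowen_ball_def)
qed

lemma bounded_phi: "bounded (phi n ` A)"
  using compact_continuous_image[OF continuous_phi compact_UNIV, of n]
  by (meson bounded_subset compact_imp_bounded image_mono subset_UNIV)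

lemma le_SUP_phi: "y \<in> A \<Longrightarrow> phi n y \<le> (SUP y\<in>A. phi n y)"
  by (intro cSUP_upper bounded_imp_bdd_above bounded_phi)

lemma distortion_ge:
  assumes "y \<in> nball T n x eps"
  shows "\<bar>phi n x - phi n y\<bar> \<le> distortion T phi n eps"
proof -
  obtain K where K: "\<And>z. \<bar>phi n z\<bar> \<le> K" using bounded_phi[of n UNIV] by (auto simp: bounded_iff)
  have "bdd_above ((\<lambda>(x, y). \<bar>phi n x - phi n y\<bar>) ` {(x, y). y \<in> nball T n x eps})"
  proof (rule bdd_aboveI2)
    fix p assume "p \<in> {(x, y). y \<in> nball T n x eps}"
    show "(case p of (x, y) \<Rightarrow> \<bar>phi n x - phi n y\<bar>) \<le> 2 * K"
      using K[of "fst p"] K[of "snd p"] by (auto simp: split_beta)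
  qed
  then show ?thesis unfolding distortion_def using assms
    by (intro cSUP_upper2[where x = "(x, y)"]) auto
qed

lemma SUP_phi_le: "(SUP y\<in>nball T n x eps. phi n y) \<le> phi n x + distortion T phi n eps"
proof (rule cSUP_least)
  show "nball T n x eps \<noteq> {}" using center_in_nball by blast
  show "phi n y \<le> phi n x + distortion T phi n eps" if "y \<in> nball T n x eps" for y
    using distortion_ge[OF that] by simp
qed

lemma MN_mono: "N \<le> N' \<Longrightarrow> MN T phi Z s eps N \<le> MN T phi Z s eps N'"
  unfolding MN_def by (intro Inf_superset_mono) fastforce

lemma MN_le_finite_cover:
  assumes G: "finite G" "\<And>n x. (n, x) \<in> G \<Longrightarrow> N \<le> n" "Z \<subseteq> (\<Union>(n, x)\<in>G. nball T n x eps)"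
  shows "MN T phi Z s eps N \<le> (\<Sum>(n, x)\<in>G. ennreal (exp (- real n * s + (SUP y\<in>nball T n x eps. phi n y))))"
proof -
  obtain h where h: "bij_betw h {0..<card G} G" using ex_bij_betw_nat_finite[OF G(1)] by blast
  then have hG: "h ` {0..<card G} = G" by (simp add: bij_betw_def)
  define g where "g = (\<lambda>(n, x). ennreal (exp (- real n * s + (SUP y\<in>nball T n x eps. phi n y))))"
  have "MN T phi Z s eps N \<le> family_sum T phi s eps {0..<card G} (\<lambda>i. snd (h i)) (\<lambda>i. fst (h i))"
    unfolding MN_def
  proof (rule Inf_lower, rule CollectI, intro exI[of _ "{0..<card G}"]
      exI[of _ "\<lambda>i. snd (h i)"] exI[of _ "\<lambda>i. fst (h i)"] conjI refl ballI)
    show "N \<le> fst (h i)" if "i \<in> {0..<card G}" for i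
      using that hG by (intro G(2)[of _ "snd (h i)"]) auto
    show "Z \<subseteq> (\<Union>i\<in>{0..<card G}. nball T (fst (h i)) (snd (h i)) eps)"
    proof -
      have "(\<Union>p\<in>h ` {0..<card G}. nball T (fst p) (snd p) eps) =
          (\<Union>i\<in>{0..<card G}. nball T (fst (h i)) (snd (h i)) eps)" by simp
      then show ?thesis using G(3) unfolding hG by (simp add: split_beta)
    qed
  qed
  also have "\<dots> = (\<Sum>i\<in>{0..<card G}. g (h i))"
    unfolding family_sum_def by (subst suminf_finite[where N = "{0..<card G}"]) (auto simp: g_def split_beta)
  also have "\<dots> = (\<Sum>p\<in>G. g p)" by (rule sum.reindex_bij_betw[OF h])
  finally show ?thesis by (simp add: g_def)
qed

text \<open>The numbers \<open>t n\<close> are positive with sums at most 1, so a point of total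
  weight at least 1 receives weight at least \<open>t n\<close> from the balls of some length
  \<open>n\<close>. This splits \<open>Z\<close> into levels \<open>Zn n\<close>, each of which is
  covered by balls around a separated net; together they form an ordinary cover, to which the bound
  on \<open>MN\<close> applies. The exponent loses \<open>eta\<close> three times: for the supremum
  of \<open>phi n\<close> over a ball against its value at the centre, for passing from a net point
  to the centre of a weighted ball, and for the factor \<open>exp (- eta) ^ n\<close> in
  \<open>t n\<close>. The factor \<open>1 - exp (- eta)\<close> normalizes the geometric
  series.\<close>

lemma weighted_cover_ge:
  assumes eta: "0 < eta"
    and N: "\<And>n. N \<le> n \<Longrightarrow> distortion T phi n eps \<le> real n * eta"
      "\<And>n. N \<le> n \<Longrightarrow> distortion T phi n (2 * eps) \<le> real n * eta"
      "\<And>n. N \<le> n \<Longrightarrow> ln 2 \<le> real n * eps"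
    and b: "0 \<le> b" "ennreal b \<le> MN T phi Z s eps N"
    and F: "finite F" "F \<subseteq> {N..} \<times> UNIV" "\<And>i. i \<in> F \<Longrightarrow> 0 \<le> c i"
    and cover: "\<And>z. z \<in> Z \<Longrightarrow> 1 \<le> (\<Sum>i\<in>F. c i * indicator (nball T (fst i) (snd i) (2 * eps)) z)"
  shows "(1 - exp (- eta)) * b \<le> (\<Sum>i\<in>F. c i * exp (- real (fst i) * (s - 3 * eta) + phi (fst i) (snd i)))"
proof -
  define q where "q = exp (- eta)"
  have q: "0 < q" "q < 1" using eta by (auto simp: q_def)
  define t where "t n = (1 - q) * q ^ n" for n
  have t_pos: "0 < t n" for n using q by (simp add: t_def)
  have t_sum: "(\<Sum>n\<in>A. t n) \<le> 1" if "finite A" for A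
  proof -
    have sm: "summable (\<lambda>n. q ^ n)" using q by (intro summable_geometric) simp
    have "(\<Sum>n\<in>A. q ^ n) \<le> (\<Sum>n. q ^ n)" using q that by (intro sum_le_suminf sm) auto
    also have "\<dots> = 1 / (1 - q)" using q by (intro suminf_geometric) simp
    finally have "(1 - q) * (\<Sum>n\<in>A. q ^ n) \<le> (1 - q) * (1 / (1 - q))" using q by (intro mult_left_mono) auto
    also have "\<dots> = 1" using q by simp
    finally show ?thesis by (simp only: t_def sum_distrib_left)
  qed
  define w where "w i = exp (- real (fst i) * (s - 3 * eta) + phi (fst i) (snd i))" for i
  define B where "B i = nball T (fst i) (snd i) (2 * eps)" for i
  define I where "I n = {i \<in> F. fst i = n}" for n
  define Zn where "Zn n = {z \<in> Z. t n \<le> (\<Sum>i\<in>I n. c i * indicator (B i) z)}" for n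
  define M where "M = fst ` F"
  have fin: "finite (I n)" "finite M" for n using F(1) by (auto simp: I_def M_def)
  have MN: "N \<le> n" if "n \<in> M" for n using that F(2) by (auto simp: M_def)
  have BI: "y \<in> nball T n x eps" if "n \<in> M" "i \<in> I n" "x \<in> B i" "y \<in> B i" for n i x y
    using nball_double[of n eps x "snd i" y] N(3) MN that by (auto simp: B_def I_def)
  have group: "(\<Sum>i\<in>F. g i) = (\<Sum>n\<in>M. \<Sum>i\<in>I n. g i)" for g :: "nat \<times> 'a \<Rightarrow> real"
    unfolding M_def I_def by (rule sum.image_gen[OF F(1)])
  \<comment> \<open>Each ball of radius \<open>exp (- 2 * n * eps)\<close> contains at most one point of the separated set \<open>E n\<close>, so the
    weights collected at different points of \<open>E n\<close> come from different balls.\<close>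
  have "\<exists>E. finite E \<and> E \<subseteq> Zn n \<and> pairwise (\<lambda>x y. y \<notin> nball T n x eps) E \<and> Zn n \<subseteq> (\<Union>x\<in>E. nball T n x eps)"
    if n: "n \<in> M" for n
  proof -
    have "Zn n \<subseteq> (\<Union>i\<in>I n. B i)"
    proof
      fix z assume "z \<in> Zn n"
      then have "(\<Sum>i\<in>I n. c i * indicator (B i) z) \<noteq> 0" using t_pos[of n] by (auto simp: Zn_def simp del: sum_mult_indicator)
      then obtain i where "i \<in> I n" "c i * indicator (B i) z \<noteq> 0" by (meson sum.not_neutral_contains_not_neutral)
      then show "z \<in> (\<Union>i\<in>I n. B i)" by (auto simp: indicator_def split: if_splits)
    qed
    then obtain E where E: "finite E" "E \<subseteq> Zn n" "pairwise (\<lambda>x y. \<not> y \<in> nball T n x eps) E"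
      "\<And>y. y \<in> Zn n \<Longrightarrow> \<exists>x\<in>E. y \<in> nball T n x eps"
    proof (rule finite_separated_net[where R = "\<lambda>x y. y \<in> nball T n x eps", OF fin(1)])
      show "y \<in> nball T n x eps" if "i \<in> I n" "x \<in> B i" "y \<in> B i" for i x y
        using BI[OF n] that .
      show "x \<in> nball T n y eps" if "y \<in> nball T n x eps" for x y
        using that by (simp add: nball_sym)
    qed (rule that)
    then have "Zn n \<subseteq> (\<Union>x\<in>E. nball T n x eps)" by blast
    with E show ?thesis by blast
  qed
  then obtain E where E: "\<And>n. n \<in> M \<Longrightarrow> finite (E n)" "\<And>n. n \<in> M \<Longrightarrow> E n \<subseteq> Zn n"
    "\<And>n. n \<in> M \<Longrightarrow> pairwise (\<lambda>x y. y \<notin> nball T n x eps) (E n)"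
    "\<And>n. n \<in> M \<Longrightarrow> Zn n \<subseteq> (\<Union>x\<in>E n. nball T n x eps)"
    by metis
  have "Z \<subseteq> (\<Union>n\<in>M. Zn n)"
  proof
    fix z assume z: "z \<in> Z"
    show "z \<in> (\<Union>n\<in>M. Zn n)"
    proof (rule ccontr)
      assume "z \<notin> (\<Union>n\<in>M. Zn n)"
      then have less: "(\<Sum>i\<in>I n. c i * indicator (B i) z) < t n" if "n \<in> M" for n
        using that z by (auto simp: Zn_def not_le)
      have "M \<noteq> {}" using cover[OF z] by (auto simp: M_def)
      then have "(\<Sum>n\<in>M. \<Sum>i\<in>I n. c i * indicator (B i) z) < (\<Sum>n\<in>M. t n)"
        using fin less by (intro sum_strict_mono) auto
      then show False using cover[OF z] t_sum[OF fin(2)] unfolding group B_def by linarith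
    qed
  qed
  then have cov: "Z \<subseteq> (\<Union>(n, x)\<in>Sigma M E. nball T n x eps)" using E(4) by fastforce
  have "ennreal b \<le> (\<Sum>(n, x)\<in>Sigma M E. ennreal (exp (- real n * s + (SUP y\<in>nball T n x eps. phi n y))))"
    using b(2) by (rule order_trans) (intro MN_le_finite_cover cov finite_SigmaI fin E; use MN in auto)
  also have "\<dots> \<le> (\<Sum>(n, x)\<in>Sigma M E. ennreal (exp (- real n * s + phi n x + real n * eta)))"
  proof (intro sum_mono, clarsimp)
    fix n x assume "n \<in> M"
    then show "(SUP y\<in>nball T n x eps. phi n y) \<le> phi n x + real n * eta"
      using SUP_phi_le[of n x eps] N(1)[OF MN, of n] by linarith
  qed
  also have "\<dots> = ennreal (\<Sum>(n, x)\<in>Sigma M E. exp (- real n * s + phi n x + real n * eta))"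
    by (subst sum_ennreal[symmetric]) (auto simp: split_beta)
  finally have "b \<le> (\<Sum>(n, x)\<in>Sigma M E. exp (- real n * s + phi n x + real n * eta))"
    by (subst (asm) ennreal_le_iff) (auto intro!: sum_nonneg)
  also have "\<dots> = (\<Sum>n\<in>M. \<Sum>x\<in>E n. exp (- real n * s + phi n x + real n * eta))"
    using fin E(1) by (subst sum.Sigma) auto
  finally have "(1 - q) * b \<le> (1 - q) * (\<Sum>n\<in>M. \<Sum>x\<in>E n. exp (- real n * s + phi n x + real n * eta))"
    using q by (intro mult_left_mono) auto
  also have "\<dots> = (\<Sum>n\<in>M. \<Sum>x\<in>E n. (1 - q) * exp (- real n * s + phi n x + real n * eta))"
    by (simp add: sum_distrib_left)
  also have "\<dots> \<le> (\<Sum>n\<in>M. \<Sum>i\<in>I n. c i * w i)"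
  proof (rule sum_mono)
    fix n assume n: "n \<in> M"
    have "(1 - q) * exp (- real n * s + phi n x + real n * eta) \<le> (\<Sum>i\<in>I n. c i * w i * indicator (B i) x)"
      if x: "x \<in> E n" for x
    proof -
      \<comment> \<open>\<open>v\<close> bounds \<open>w i\<close> from below for every weighted
        ball \<open>B i\<close> of length \<open>n\<close> through \<open>x\<close>, and
        \<open>t n * v\<close> is exactly the term of the unweighted sum.\<close>
      define v where "v = exp (- real n * (s - 3 * eta) + phi n x - real n * eta)"
      have "q ^ n = exp (- real n * eta)" by (simp add: q_def exp_of_nat_mult[symmetric])
      then have "(1 - q) * exp (- real n * s + phi n x + real n * eta) = t n * v"
        by (simp add: t_def v_def mult_exp_exp algebra_simps)
      also have "\<dots> \<le> (\<Sum>i\<in>I n. c i * indicator (B i) x) * v"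
        using x E(2)[OF n] by (intro mult_right_mono) (auto simp: Zn_def v_def)
      also have "\<dots> = (\<Sum>i\<in>I n. c i * indicator (B i) x * v)" by (rule sum_distrib_right)
      also have "\<dots> \<le> (\<Sum>i\<in>I n. c i * w i * indicator (B i) x)"
      proof (rule sum_mono)
        fix i assume i: "i \<in> I n"
        then have iF: "i \<in> F" "fst i = n" by (auto simp: I_def)
        show "c i * indicator (B i) x * v \<le> c i * w i * indicator (B i) x"
        proof (cases "x \<in> B i")
          case True
          then have "\<bar>phi n (snd i) - phi n x\<bar> \<le> real n * eta"
            using distortion_ge[of x n "snd i" "2 * eps"] N(2)[OF MN[OF n]] iF by (auto simp: B_def)
          then have "v \<le> w i" using iF by (simp add: v_def w_def)
          then show ?thesis using F(3)[OF iF(1)] True by (simp add: mult_left_mono)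
        qed simp
      qed
      finally show ?thesis .
    qed
    then have "(\<Sum>x\<in>E n. (1 - q) * exp (- real n * s + phi n x + real n * eta))
        \<le> (\<Sum>x\<in>E n. \<Sum>i\<in>I n. c i * w i * indicator (B i) x)" by (rule sum_mono)
    also have "\<dots> = (\<Sum>i\<in>I n. \<Sum>x\<in>E n. c i * w i * indicator (B i) x)" by (rule sum.swap)
    also have "\<dots> \<le> (\<Sum>i\<in>I n. c i * w i)"
    proof (rule sum_mono)
      fix i assume i: "i \<in> I n"
      have "(\<Sum>x\<in>E n. c i * w i * indicator (B i) x) = c i * w i * real (card (E n \<inter> B i))"
        using E(1)[OF n] by (simp add: sum_distrib_left[symmetric] sum.If_cases indicator_def[abs_def] del: sum_mult_indicator)
      also have "card (E n \<inter> B i) \<le> Suc 0"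
        using E(1,3)[OF n] BI[OF n i] by (subst card_le_Suc0_iff_eq) (auto simp: pairwise_def)
      then have "c i * w i * real (card (E n \<inter> B i)) \<le> c i * w i * 1"
        using F(3) i by (intro mult_left_mono) (auto simp: I_def w_def)
      finally show "(\<Sum>x\<in>E n. c i * w i * indicator (B i) x) \<le> c i * w i" by simp
    qed
    finally show "(\<Sum>x\<in>E n. (1 - q) * exp (- real n * s + phi n x + real n * eta)) \<le> (\<Sum>i\<in>I n. c i * w i)" .
  qed
  also have "\<dots> = (\<Sum>i\<in>F. c i * w i)" by (rule group[symmetric])
  finally show ?thesis unfolding q_def w_def .
qed

section \<open>A Frostman lemma\<close>

text \<open>\<open>exp k\<close> is the reciprocal of the lower bound \<open>K\<close> for the cost
  of weighted covers. Being independent of \<open>n\<close> and \<open>x\<close>, it is lost in the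
  limit that defines the local pressure.\<close>

lemma ex_measure_nball_le:
  assumes eta: "0 < eta" and eps: "0 < eps"
    and N: "\<And>n. N \<le> n \<Longrightarrow> distortion T phi n eps \<le> real n * eta"
      "\<And>n. N \<le> n \<Longrightarrow> distortion T phi n (2 * eps) \<le> real n * eta"
      "\<And>n. N \<le> n \<Longrightarrow> ln 2 \<le> real n * eps"
    and pos: "MN T phi Z s eps N \<noteq> 0"
    and Z: "compact Z"
  obtains \<mu> k where "\<mu> \<in> probs_on Z"
    "\<And>n x. N \<le> n \<Longrightarrow> emeasure \<mu> (nball T n x (2 * eps)) \<le> ennreal (exp (k - real n * (s - 3 * eta) + phi n x))"
proof -
  \<comment> \<open>\<open>MN\<close> may be infinite; any positive real number below it
    serves.\<close>
  obtain b where b: "0 < b" "ennreal b \<le> MN T phi Z s eps N"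
  proof (cases "MN T phi Z s eps N")
    case (real r)
    then show ?thesis using pos by (intro that[of r]) (auto simp: less_le)
  next
    case top
    then show ?thesis by (intro that[of 1]) auto
  qed
  define K where "K = (1 - exp (- eta)) * b"
  have K: "0 < K" using b eta by (simp add: K_def)
  define w where "w i = exp (- real (fst i) * (s - 3 * eta) + phi (fst i) (snd i)) / K" for i
  define B where "B i = nball T (fst i) (snd i) (2 * eps)" for i
  \<comment> \<open>A finite cover at the single level \<open>N\<close> makes the cost of every
    bounded function finite.\<close>
  obtain C where C: "finite C" "Z \<subseteq> (\<Union>x\<in>C. nball T N x (2 * eps))"
    using compactE_image[OF Z, of Z "\<lambda>x. nball T N x (2 * eps)"] open_nball center_in_nball
    by (metis UN_I subsetI)
  obtain m :: "'a set \<Rightarrow> real" where m: "\<And>A. 0 \<le> m A" "\<And>A C. A \<inter> C = {} \<Longrightarrow> m (A \<union> C) = m A + m C"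
    "m Z = 1" "m (- Z) = 0" "\<And>i. i \<in> {N..} \<times> UNIV \<Longrightarrow> m (B i) \<le> w i"
  proof (rule charge_le_weighted_cover[of "{N..} \<times> UNIV" w "(\<lambda>x. (N, x)) ` C" Z B])
    show "0 \<le> w i" for i using K by (simp add: w_def)
    show "finite ((\<lambda>x. (N, x)) ` C)" using C by simp
    show "(\<lambda>x. (N, x)) ` C \<subseteq> {N..} \<times> UNIV" by auto
    show "Z \<subseteq> (\<Union>i\<in>(\<lambda>x. (N, x)) ` C. B i)" using C by (auto simp: B_def)
    show "1 \<le> (\<Sum>i\<in>F. c i * w i)"
      if "finite F" "F \<subseteq> {N..} \<times> UNIV" "\<And>i. i \<in> F \<Longrightarrow> 0 \<le> c i"
        "\<And>z. z \<in> Z \<Longrightarrow> 1 \<le> (\<Sum>i\<in>F. c i * indicator (B i) z)" for F c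
    proof -
      have "K \<le> (\<Sum>i\<in>F. c i * exp (- real (fst i) * (s - 3 * eta) + phi (fst i) (snd i)))"
        unfolding K_def using b eta N that unfolding B_def by (intro weighted_cover_ge[of eta N eps b Z s F c]) auto
      then show ?thesis using K by (simp add: w_def sum_divide_distrib[symmetric] le_divide_eq)
    qed
  qed blast
  obtain \<mu> where \<mu>: "\<mu> \<in> probs_on Z" "\<And>U. open U \<Longrightarrow> emeasure \<mu> U \<le> ennreal (m U)"
    using borel_measure_le_charge[OF m(1,2) Z m(3,4)] by blast
  have "emeasure \<mu> (nball T n x (2 * eps)) \<le> ennreal (exp (- ln K - real n * (s - 3 * eta) + phi n x))" if "N \<le> n" for n x
  proof -
    have "emeasure \<mu> (nball T n x (2 * eps)) \<le> ennreal (m (nball T n x (2 * eps)))"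
      by (intro \<mu> open_nball)
    also have "m (nball T n x (2 * eps)) \<le> w (n, x)" using m(5)[of "(n, x)"] that by (simp add: B_def)
    also have "w (n, x) = exp (- ln K - real n * (s - 3 * eta) + phi n x)"
    proof -
      have "exp r / K = exp (- ln K + r)" for r using K by (simp add: exp_diff)
      then show ?thesis by (simp add: w_def algebra_simps)
    qed
    finally show ?thesis by (simp add: ennreal_leI)
  qed
  with \<mu>(1) show thesis by (rule that)
qed

lemma lowerBK_ge:
  assumes \<mu>: "\<mu> \<in> probs_on Z"
    and le: "\<And>n x. N \<le> n \<Longrightarrow> emeasure \<mu> (nball T n x eps) \<le> ennreal (exp (k - real n * c + phi n x))"
  shows "ereal c \<le> lowerBK \<mu> T phi eps"
  unfolding lowerBK_def
proof (rule ereal_integral_ge)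
  show "prob_space \<mu>" using \<mu> by (simp add: probs_on_def)
  fix x
  have "(\<lambda>n. ereal (c - k / real n)) \<longlonglongrightarrow> ereal (c - 0)"
    by (intro tendsto_intros lim_const_over_n)
  from lim_imp_Liminf[OF trivial_limit_sequentially this]
  have "ereal c = liminf (\<lambda>n. ereal (c - k / real n))" by simp
  also have "\<dots> \<le> lowerBK_local \<mu> T phi eps x"
    unfolding lowerBK_local_def
  proof (rule Liminf_mono, rule eventually_sequentiallyI[of "max N 1"])
    fix n assume "max N 1 \<le> n"
    then have n: "N \<le> n" "0 < n" by auto
    have "ereal (- (k - real n * c + phi n x)) + ereal (phi n x)
        \<le> neglog (emeasure \<mu> (nball T n x eps)) + ereal (phi n x)"
      by (intro add_right_mono neglog_ge le n)
    then have "ereal (real n * c - k) \<le> neglog (emeasure \<mu> (nball T n x eps)) + ereal (phi n x)" by simp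
    then have "ereal (real n * c - k) / ereal (real n) \<le> (neglog (emeasure \<mu> (nball T n x eps)) + ereal (phi n x)) / ereal (real n)"
      using n by (intro ereal_divide_right_mono) auto
    then show "ereal (c - k / real n) \<le> (neglog (emeasure \<mu> (nball T n x eps)) + ereal (phi n x)) / ereal (real n)"
      using n by (simp add: diff_divide_distrib)
  qed
  finally show "ereal c \<le> lowerBK_local \<mu> T phi eps x" .
qed

lemma Meps_le_SUP_lowerBK:
  assumes eta: "0 < eta" and eps: "0 < eps"
    and N: "\<And>n. N \<le> n \<Longrightarrow> distortion T phi n eps \<le> real n * eta"
      "\<And>n. N \<le> n \<Longrightarrow> distortion T phi n (2 * eps) \<le> real n * eta"
    and Z: "compact Z"
  shows "Meps T phi Z eps \<le> (SUP \<mu>\<in>probs_on Z. lowerBK \<mu> T phi (2 * eps)) + ereal (3 * eta)"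
proof (rule ccontr)
  assume "\<not> ?thesis"
  then obtain s where s: "(SUP \<mu>\<in>probs_on Z. lowerBK \<mu> T phi (2 * eps)) + ereal (3 * eta) < ereal s" "ereal s < Meps T phi Z eps"
    using ereal_dense2 by (auto simp: not_le)
  have "Ms T phi Z s eps \<noteq> 0"
  proof
    assume "Ms T phi Z s eps = 0"
    then have "Meps T phi Z eps \<le> ereal s" unfolding Meps_def by (intro Inf_lower) auto
    then show False using s(2) by simp
  qed
  then obtain N0 where N0: "MN T phi Z s eps N0 \<noteq> 0" unfolding Ms_def by (metis SUP_eq_const UNIV_not_empty) 
  define N1 where "N1 = max N (max N0 (nat \<lceil>ln 2 / eps\<rceil>))"
  have "MN T phi Z s eps N0 \<le> MN T phi Z s eps N1"
    by (rule MN_mono) (simp add: N1_def)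
  then have N1: "MN T phi Z s eps N1 \<noteq> 0" using N0 by (metis le_zero_eq)
  have ln: "ln 2 \<le> real n * eps" if "N1 \<le> n" for n
  proof -
    have "ln 2 / eps \<le> real n" using that unfolding N1_def by linarith
    then show ?thesis using eps by (simp add: divide_le_eq)
  qed
  obtain \<mu> k where \<mu>: "\<mu> \<in> probs_on Z"
    "\<And>n x. N1 \<le> n \<Longrightarrow> emeasure \<mu> (nball T n x (2 * eps)) \<le> ennreal (exp (k - real n * (s - 3 * eta) + phi n x))"
    using ex_measure_nball_le[OF eta eps _ _ ln N1 Z] N by (metis N1_def max.bounded_iff)
  have "ereal (s - 3 * eta) \<le> (SUP \<mu>\<in>probs_on Z. lowerBK \<mu> T phi (2 * eps))"
    using lowerBK_ge[OF \<mu>] by (intro SUP_upper2[OF \<mu>(1)])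
  then have "ereal (s - 3 * eta) + ereal (3 * eta) \<le> (SUP \<mu>\<in>probs_on Z. lowerBK \<mu> T phi (2 * eps)) + ereal (3 * eta)"
    by (rule add_right_mono)
  then show False using s(1) by simp
qed

section \<open>Comparison of the pressures\<close>

lemma family_sum_antimono: "s \<le> s' \<Longrightarrow> family_sum T phi s' eps I x n \<le> family_sum T phi s eps I x n"
  unfolding family_sum_def by (intro suminf_le) (auto intro!: ennreal_leI mult_left_mono)

text \<open>A smaller scale means larger balls, so a cover at scale \<open>eps2\<close> remains one
  at \<open>eps1\<close> with the same centres and lengths. Only the suprema of \<open>phi n\<close>
  can grow, by at most the distortion at \<open>eps1\<close>, and raising \<open>s\<close> by
  \<open>eta\<close> pays for that. \<open>N\<close> is tied to \<open>eps1\<close> alone, so one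
  threshold serves all larger \<open>eps2\<close>.\<close>

lemma Meps_le_Meps_add:
  assumes "eps1 \<le> eps2" and N: "\<And>n. N \<le> n \<Longrightarrow> distortion T phi n eps1 \<le> real n * eta"
  shows "Meps T phi Z eps1 \<le> Meps T phi Z eps2 + ereal eta"
proof (rule ccontr)
  assume "\<not> ?thesis"
  then have "Meps T phi Z eps2 < Meps T phi Z eps1 - ereal eta"
    by (simp add: not_le ereal_less_minus_iff)
  then obtain s where s: "Ms T phi Z s eps2 = 0" "ereal s < Meps T phi Z eps1 - ereal eta"
    unfolding Meps_def[of T phi Z eps2] Inf_less_iff by auto
  have "MN T phi Z (s + eta) eps1 k = 0" for k
  proof -
    have "MN T phi Z (s + eta) eps1 k \<le> MN T phi Z (s + eta) eps1 (max k N)" by (rule MN_mono) simp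
    also have "\<dots> \<le> MN T phi Z s eps2 (max k N)"
      unfolding MN_def[of T phi Z s]
    proof (rule Inf_greatest, clarify)
      fix I :: "nat set" and x :: "nat \<Rightarrow> 'a" and n assume n: "\<forall>i\<in>I. max k N \<le> n i" and cov: "Z \<subseteq> (\<Union>i\<in>I. nball T (n i) (x i) eps2)"
      have "MN T phi Z (s + eta) eps1 (max k N) \<le> family_sum T phi (s + eta) eps1 I x n"
        unfolding MN_def using n cov nball_antimono[OF assms(1)]
        by (intro Inf_lower CollectI exI[of _ I] exI[of _ x] exI[of _ n] conjI refl) blast+
      also have "\<dots> \<le> family_sum T phi s eps2 I x n"
        unfolding family_sum_def
      proof (rule suminf_le)
        fix i
        show "(if i \<in> I then ennreal (exp (- real (n i) * (s + eta) + (SUP y\<in>nball T (n i) (x i) eps1. phi (n i) y))) else 0)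
          \<le> (if i \<in> I then ennreal (exp (- real (n i) * s + (SUP y\<in>nball T (n i) (x i) eps2. phi (n i) y))) else 0)"
        proof (cases "i \<in> I")
          case True
          then have "distortion T phi (n i) eps1 \<le> real (n i) * eta" using n N by auto
          then have "(SUP y\<in>nball T (n i) (x i) eps1. phi (n i) y) \<le> (SUP y\<in>nball T (n i) (x i) eps2. phi (n i) y) + real (n i) * eta"
            using SUP_phi_le[of "n i" "x i" eps1] le_SUP_phi[OF center_in_nball[of "x i" "n i" eps2], of "n i"] by linarith
          then show ?thesis using True by (auto intro!: ennreal_leI simp: distrib_left)
        qed simp
      qed auto
      finally show "MN T phi Z (s + eta) eps1 (max k N) \<le> family_sum T phi s eps2 I x n" .
    qed
    also have "\<dots> \<le> Ms T phi Z s eps2" unfolding Ms_def by (rule SUP_upper) simp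
    finally show ?thesis using s(1) by simp
  qed
  then have "Ms T phi Z (s + eta) eps1 = 0" by (simp add: Ms_def)
  then have "Meps T phi Z eps1 \<le> ereal (s + eta)" unfolding Meps_def by (intro Inf_lower) auto
  then show False using s(2) by (simp add: ereal_less_minus_iff)
qed

text \<open>A cover of \<open>Z\<close> has measure at least 1, more than \<open>1 - delta\<close>,
  so it competes in the Katok infimum as well.\<close>

lemma Lambda_eps_le_Meps:
  assumes "\<mu> \<in> probs_on Z" "0 < delta"
  shows "Lambda_eps \<mu> T phi delta eps \<le> Meps T phi Z eps"
proof -
  have em: "ennreal (1 - delta) < emeasure \<mu> (\<Union>i\<in>I. nball T (n i) (x i) eps)"
    if "Z \<subseteq> (\<Union>i\<in>I. nball T (n i) (x i) eps)" for I :: "nat set" and n x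
  proof -
    have "ennreal (1 - delta) < 1" using assms(2) by (simp add: ennreal_less_one_iff)
    also have "1 = emeasure \<mu> Z" using assms(1) by (simp add: probs_on_def)
    also have "\<dots> \<le> emeasure \<mu> (\<Union>i\<in>I. nball T (n i) (x i) eps)"
      using assms(1) that by (intro emeasure_mono) (auto simp: probs_on_def intro!: borel_open open_nball open_UN)
    finally show ?thesis .
  qed
  have "LambdaN \<mu> T phi delta s eps N \<le> MN T phi Z s eps N" for s N
    unfolding LambdaN_def MN_def using em by (intro Inf_superset_mono) blast
  then have "Lambdas \<mu> T phi delta s eps \<le> Ms T phi Z s eps" for s
    unfolding Lambdas_def Ms_def by (intro SUP_mono) auto
  then have "Ms T phi Z s eps = 0 \<Longrightarrow> Lambdas \<mu> T phi delta s eps = 0" for s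
    by (metis le_zero_eq)
  then show ?thesis unfolding Lambda_eps_def Meps_def by (intro Inf_superset_mono) auto
qed

lemma Lambda_eps_antimono:
  assumes "delta1 \<le> delta2"
  shows "Lambda_eps \<mu> T phi delta2 eps \<le> Lambda_eps \<mu> T phi delta1 eps"
proof -
  have "ennreal (1 - delta2) \<le> ennreal (1 - delta1)" using assms by (intro ennreal_leI) simp
  then have "LambdaN \<mu> T phi delta2 s eps N \<le> LambdaN \<mu> T phi delta1 s eps N" for s N
    unfolding LambdaN_def by (intro Inf_superset_mono) (blast intro: le_less_trans)
  then have "Lambdas \<mu> T phi delta2 s eps \<le> Lambdas \<mu> T phi delta1 s eps" for s
    unfolding Lambdas_def by (intro SUP_mono) auto
  then have "Lambdas \<mu> T phi delta1 s eps = 0 \<Longrightarrow> Lambdas \<mu> T phi delta2 s eps = 0" for s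
    by (metis le_zero_eq)
  then show ?thesis unfolding Lambda_eps_def by (intro Inf_superset_mono) auto
qed

text \<open>\<open>Lim\<close> is informative only once a limit is known to exist; here monotonicity
  in \<open>delta\<close> provides one, the supremum over positive \<open>delta\<close>.\<close>

lemma Lambda_eps_tendsto_katok:
  "((\<lambda>delta. Lambda_eps \<mu> T phi delta eps) \<longlongrightarrow> katok \<mu> T phi eps) (at_right 0)"
proof -
  define f where "f delta = Lambda_eps \<mu> T phi delta eps" for delta
  have "(f \<longlongrightarrow> (SUP delta\<in>{0<..}. f delta)) (at_right 0)"
  proof (rule order_tendstoI)
    fix a assume "a < (SUP delta\<in>{0<..}. f delta)"
    then obtain d where d: "0 < d" "a < f d" by (auto simp: less_SUP_iff)
    then have "a < f delta" if "delta < d" for delta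
      using Lambda_eps_antimono[of delta d \<mu> eps] that unfolding f_def by (meson less_imp_le less_le_trans)
    then show "\<forall>\<^sub>F delta in at_right 0. a < f delta"
      using d(1) by (auto simp: eventually_at_right_field)
  next
    fix a assume a: "(SUP delta\<in>{0<..}. f delta) < a"
    have "f delta < a" if "0 < delta" for delta
      using a that by (intro le_less_trans[OF SUP_upper a]) auto
    then show "\<forall>\<^sub>F delta in at_right 0. f delta < a"
      by (auto simp: eventually_at_right_field intro: exI[of _ 1])
  qed
  moreover from this have "katok \<mu> T phi eps = (SUP delta\<in>{0<..}. f delta)"
    unfolding katok_def f_def by (intro tendsto_Lim) auto
  ultimately show ?thesis unfolding f_def by simp
qed

lemma katok_le_Meps:
  assumes "\<mu> \<in> probs_on Z"
  shows "katok \<mu> T phi eps \<le> Meps T phi Z eps"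
  using Lambda_eps_le_Meps[OF assms]
  by (intro tendsto_upperbound[OF Lambda_eps_tendsto_katok])
     (auto simp: eventually_at_right_field intro: exI[of _ 1])

text \<open>A mass distribution argument. A family whose union has measure above
  \<open>1 - delta\<close> misses at most \<open>delta\<close> of the outer measure of
  \<open>A\<close>. Only its balls meeting \<open>A\<close> are kept; by \<open>nball_double\<close>
  such a ball lies in the ball of scale \<open>eps\<close> about any of its points in
  \<open>A\<close>, where the bound on the measure applies. So every admissible sum with exponent
  \<open>c\<close> is at least \<open>outer_measure_of \<mu> A - delta\<close>.\<close>

lemma Lambda_eps_ge:
  assumes \<mu>: "prob_space \<mu>" "sets \<mu> = sets borel" and eps: "0 < eps"
    and A: "\<And>n y. k \<le> n \<Longrightarrow> y \<in> A \<Longrightarrow> emeasure \<mu> (nball T n y eps) \<le> ennreal (exp (- real n * c + phi n y))"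
    and delta: "ennreal delta < outer_measure_of \<mu> A" "0 < delta" "delta < 1"
  shows "ereal c \<le> Lambda_eps \<mu> T phi delta (2 * eps)"
  unfolding Lambda_eps_def
proof (rule Inf_greatest, clarify)
  interpret prob_space \<mu> by fact
  have space: "space \<mu> = UNIV" using sets_eq_imp_space_eq[OF \<mu>(2)] by simp
  fix s assume s: "Lambdas \<mu> T phi delta s (2 * eps) = 0"
  define N where "N = max k (nat \<lceil>ln 2 / eps\<rceil>)"
  have ln: "ln 2 \<le> real n * eps" if "N \<le> n" for n
  proof -
    have "ln 2 / eps \<le> real n" using that unfolding N_def by linarith
    then show ?thesis using eps by (simp add: divide_le_eq)
  qed
  have "outer_measure_of \<mu> A - ennreal delta \<le> LambdaN \<mu> T phi delta c (2 * eps) N"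
    unfolding LambdaN_def
  proof (rule Inf_greatest, clarify)
    fix I :: "nat set" and x :: "nat \<Rightarrow> 'a" and n assume n: "\<forall>i\<in>I. N \<le> n i"
      and cov: "ennreal (1 - delta) < emeasure \<mu> (\<Union>i\<in>I. nball T (n i) (x i) (2 * eps))"
    define B where "B i = nball T (n i) (x i) (2 * eps)" for i
    define C where "C i = (if i \<in> I \<and> B i \<inter> A \<noteq> {} then B i else {})" for i
    define U where "U = (\<Union>i\<in>I. B i)"
    have Bs: "B i \<in> sets \<mu>" for i unfolding B_def \<mu>(2) by (intro borel_open open_nball)
    then have Cs: "range C \<subseteq> sets \<mu>" by (auto simp: C_def)
    have Us: "U \<in> sets \<mu>" unfolding U_def using Bs by (intro sets.countable_UN') auto
    have "1 - delta < prob U"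
      using cov delta by (simp add: U_def B_def emeasure_eq_measure ennreal_less_iff)
    then have "prob (space \<mu> - U) \<le> delta" using prob_compl[OF Us] by simp
    then have cU: "emeasure \<mu> (- U) \<le> ennreal delta"
      by (simp add: emeasure_eq_measure space Compl_eq_Diff_UNIV ennreal_leI)
    have "A \<subseteq> - U \<union> (\<Union>i. C i)" by (auto simp: U_def C_def)
    then have "outer_measure_of \<mu> A \<le> outer_measure_of \<mu> (- U \<union> (\<Union>i. C i))"
      by (rule outer_measure_of_mono)
    also have "\<dots> = emeasure \<mu> (- U \<union> (\<Union>i. C i))"
      using Us Cs space sets.compl_sets[OF Us] by (intro outer_measure_of_eq sets.Un sets.countable_UN) (auto simp: Compl_eq_Diff_UNIV)
    also have "\<dots> \<le> emeasure \<mu> (- U) + emeasure \<mu> (\<Union>i. C i)"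
      using Us Cs space sets.compl_sets[OF Us] by (intro emeasure_subadditive sets.countable_UN) (auto simp: Compl_eq_Diff_UNIV)
    also have "\<dots> \<le> ennreal delta + (\<Sum>i. emeasure \<mu> (C i))"
      by (intro add_mono cU emeasure_subadditive_countably Cs)
    also have "(\<Sum>i. emeasure \<mu> (C i)) \<le> family_sum T phi c (2 * eps) I x n"
      unfolding family_sum_def
    proof (rule suminf_le)
      fix i
      show "emeasure \<mu> (C i) \<le> (if i \<in> I then ennreal (exp (- real (n i) * c + (SUP y\<in>nball T (n i) (x i) (2 * eps). phi (n i) y))) else 0)"
      proof (cases "i \<in> I \<and> B i \<inter> A \<noteq> {}")
        case True
        then obtain y where y: "y \<in> B i" "y \<in> A" by blast
        have ni: "N \<le> n i" using n True by blast
        have "C i \<subseteq> nball T (n i) y eps"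
          using nball_double[OF ln[OF ni], of y "x i"] y True by (auto simp: C_def B_def)
        then have "emeasure \<mu> (C i) \<le> emeasure \<mu> (nball T (n i) y eps)"
          using \<mu>(2) open_nball by (intro emeasure_mono) auto
        also have "\<dots> \<le> ennreal (exp (- real (n i) * c + phi (n i) y))"
          using ni y by (intro A) (auto simp: N_def)
        also have "\<dots> \<le> ennreal (exp (- real (n i) * c + (SUP y\<in>nball T (n i) (x i) (2 * eps). phi (n i) y)))"
          using y by (auto intro!: ennreal_leI le_SUP_phi simp: B_def)
        finally show ?thesis using True by simp
      qed (auto simp: C_def)
    qed auto
    finally show "outer_measure_of \<mu> A - ennreal delta \<le> family_sum T phi c (2 * eps) I x n"
      by (subst ennreal_minus_le_iff) (auto simp: add_left_mono)
  qed
  moreover have "outer_measure_of \<mu> A - ennreal delta \<noteq> 0" using delta(1) by (simp add: diff_eq_0_iff_ennreal not_le)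
  ultimately have pos: "LambdaN \<mu> T phi delta c (2 * eps) N \<noteq> 0" by auto
  show "ereal c \<le> ereal s"
  proof (rule ccontr)
    assume "\<not> ?thesis"
    then have "s \<le> c" by simp
    then have "LambdaN \<mu> T phi delta c (2 * eps) N \<le> LambdaN \<mu> T phi delta s (2 * eps) N"
      unfolding LambdaN_def by (intro Inf_mono) (blast intro: family_sum_antimono)
    also have "\<dots> \<le> Lambdas \<mu> T phi delta s (2 * eps)" unfolding Lambdas_def by (rule SUP_upper) simp
    finally show False using pos s by simp
  qed
qed

text \<open>If every \<open>A k\<close> had outer measure zero, their measurable hulls would form a
  null set outside which the local pressure is at most \<open>c\<close>, against the choice of
  \<open>c\<close>. An \<open>A k\<close> of positive outer measure feeds
  \<open>Lambda_eps_ge\<close> for all small \<open>delta\<close>.\<close>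

lemma lowerBK_le_katok:
  assumes \<mu>: "prob_space \<mu>" "sets \<mu> = sets borel" and eps: "0 < eps"
  shows "lowerBK \<mu> T phi eps \<le> katok \<mu> T phi (2 * eps)"
proof (rule ccontr)
  assume "\<not> ?thesis"
  then obtain c where c: "katok \<mu> T phi (2 * eps) < ereal c" "ereal c < lowerBK \<mu> T phi eps"
    using ereal_dense2 by (auto simp: not_le)
  interpret prob_space \<mu> by fact
  have space: "space \<mu> = UNIV" using sets_eq_imp_space_eq[OF \<mu>(2)] by simp
  define A where "A k = {y. \<forall>n\<ge>k. emeasure \<mu> (nball T n y eps) \<le> ennreal (exp (- real n * c + phi n y))}" for k
  have sub: "\<exists>k. x \<in> A k" if "ereal c < lowerBK_local \<mu> T phi eps x" for x
  proof -
    have "\<forall>\<^sub>F n in sequentially. ereal c < (neglog (emeasure \<mu> (nball T n x eps)) + ereal (phi n x)) / ereal (real n)"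
      using that unfolding lowerBK_local_def by (rule less_LiminfD)
    then obtain k where k: "\<And>n. k \<le> n \<Longrightarrow> ereal c < (neglog (emeasure \<mu> (nball T n x eps)) + ereal (phi n x)) / ereal (real n)"
      by (auto simp: eventually_sequentially)
    \<comment> \<open>\<open>max k 1\<close> discards \<open>n = 0\<close>, where the quotient by
      \<open>n\<close> cannot be multiplied out.\<close>
    have "emeasure \<mu> (nball T n x eps) \<le> ennreal (exp (- real n * c + phi n x))" if n: "max k 1 \<le> n" for n
    proof (rule le_exp_of_neglog_gt)
      have "0 < ereal (real n)" using n by simp
      then have "ereal c * ereal (real n) < neglog (emeasure \<mu> (nball T n x eps)) + ereal (phi n x)"
        using k[of n] n ereal_less_divide_pos[of "ereal (real n)"] by (simp add: mult.commute)
      then have "ereal c * ereal (real n) - ereal (phi n x) < neglog (emeasure \<mu> (nball T n x eps))"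
        by (subst ereal_minus_less_iff) (auto simp: add.commute)
      then show "ereal (- (- real n * c + phi n x)) < neglog (emeasure \<mu> (nball T n x eps))"
        by (simp add: mult.commute)
    qed (simp add: less_top[symmetric])
    then have "x \<in> A (max k 1)" unfolding A_def by blast
    then show ?thesis by blast
  qed
  have "\<exists>k. outer_measure_of \<mu> (A k) \<noteq> 0"
  proof (rule ccontr)
    assume *: "\<nexists>k. outer_measure_of \<mu> (A k) \<noteq> 0"
    have "\<exists>E\<in>sets \<mu>. A k \<subseteq> E \<and> outer_measure_of \<mu> (A k) = emeasure \<mu> E" for k
      by (rule outer_measure_of_attain) (simp add: space)
    then obtain E where E: "\<And>k. E k \<in> sets \<mu>" "\<And>k. A k \<subseteq> E k" "\<And>k. outer_measure_of \<mu> (A k) = emeasure \<mu> (E k)"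
      by metis
    have "(\<Union>k. E k) \<in> null_sets \<mu>" using E * by (intro null_sets_UN) (auto simp: null_sets_def)
    moreover have "{x \<in> space \<mu>. \<not> lowerBK_local \<mu> T phi eps x \<le> ereal c} \<subseteq> (\<Union>k. E k)"
      using sub E(2) by (auto simp: not_le) blast
    ultimately have "AE x in \<mu>. lowerBK_local \<mu> T phi eps x \<le> ereal c" by (rule AE_I')
    then have "lowerBK \<mu> T phi eps \<le> ereal c"
      unfolding lowerBK_def by (rule ereal_integral_le_AE[OF \<mu>(1)])
    then show False using c(2) by simp
  qed
  then obtain k where "outer_measure_of \<mu> (A k) \<noteq> 0" by blast
  then obtain d where d: "0 < d" "ennreal d < outer_measure_of \<mu> (A k)" "d < 1"
  proof -
    assume ne: "outer_measure_of \<mu> (A k) \<noteq> 0"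
    then have "0 < min (outer_measure_of \<mu> (A k)) 1" by (simp add: zero_less_iff_neq_zero)
    then obtain e where "0 < e" "e < min (outer_measure_of \<mu> (A k)) 1" using dense by blast
    then show thesis
      by (cases e) (auto intro!: that[of "enn2real e"] simp: ennreal_less_one_iff)
  qed
  have "\<forall>\<^sub>F delta in at_right 0. ereal c \<le> Lambda_eps \<mu> T phi delta (2 * eps)"
  proof -
    have "ereal c \<le> Lambda_eps \<mu> T phi delta (2 * eps)" if "0 < delta" "delta < d" for delta
    proof (rule Lambda_eps_ge[OF \<mu> eps])
      have "ennreal delta \<le> ennreal d" using that by (intro ennreal_leI) simp
      then show "ennreal delta < outer_measure_of \<mu> (A k)" using d(2) by (rule le_less_trans)
    qed (use that d in \<open>auto simp: A_def\<close>)
    then show ?thesis using d(1) by (auto simp: eventually_at_right_field)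
  qed
  then have "ereal c \<le> katok \<mu> T phi (2 * eps)"
    by (intro tendsto_lowerbound[OF Lambda_eps_tendsto_katok]) auto
  then show False using c(1) by simp
qed

end

section \<open>Limits as the scale tends to zero\<close>

lemma tempered_distortion_le:
  assumes "tempered_distortion T phi" "0 < eta"
  obtains e where "0 < e" "\<And>eps. 0 < eps \<Longrightarrow> eps < e \<Longrightarrow> \<exists>N. \<forall>n\<ge>N. distortion T phi n eps \<le> real n * eta"
proof -
  have "\<forall>\<^sub>F eps in at_right 0. limsup (\<lambda>n. ereal (distortion T phi n eps / real n)) < ereal eta"
    using assms unfolding tempered_distortion_def by (intro order_tendstoD) auto
  then obtain e where e: "0 < e"
    "\<And>eps. 0 < eps \<Longrightarrow> eps < e \<Longrightarrow> limsup (\<lambda>n. ereal (distortion T phi n eps / real n)) < ereal eta"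
    by (auto simp: eventually_at_right_field)
  show thesis
  proof (rule that[OF e(1)])
    fix eps :: real assume "0 < eps" "eps < e"
    then have "\<forall>\<^sub>F n in sequentially. ereal (distortion T phi n eps / real n) < ereal eta"
      by (intro Limsup_lessD e)
    then obtain N where N: "\<And>n. N \<le> n \<Longrightarrow> distortion T phi n eps / real n < eta"
      by (auto simp: eventually_sequentially)
    have "distortion T phi n eps \<le> real n * eta" if "max N 1 \<le> n" for n
      using N[of n] that by (simp add: divide_less_eq mult.commute)
    then show "\<exists>N. \<forall>n\<ge>N. distortion T phi n eps \<le> real n * eta" by blast
  qed
qed

text \<open>A value near the infimum at one scale persists, up to a small error, at all sufficiently
  small scales.\<close>

lemma tendsto_at_right_Inf_of_quasi_mono:
  fixes M :: "real \<Rightarrow> ereal"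
  assumes "\<And>eta. 0 < eta \<Longrightarrow> \<exists>e>0. \<forall>eps1 eps2. 0 < eps1 \<longrightarrow> eps1 < e \<longrightarrow> eps1 \<le> eps2 \<longrightarrow> M eps1 \<le> M eps2 + ereal eta"
  shows "(M \<longlongrightarrow> (INF eps\<in>{0<..}. M eps)) (at_right 0)"
proof (rule order_tendstoI)
  fix a assume a: "a < (INF eps\<in>{0<..}. M eps)"
  have "a < M eps" if "0 < eps" for eps
    using that by (intro less_le_trans[OF a INF_lower]) auto
  then show "\<forall>\<^sub>F eps in at_right 0. a < M eps"
    by (auto simp: eventually_at_right_field intro: exI[of _ 1])
next
  fix a assume "(INF eps\<in>{0<..}. M eps) < a"
  then obtain eps2 where e2: "0 < eps2" "M eps2 < a" by (auto simp: INF_less_iff)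
  \<comment> \<open>\<open>M eps2\<close> and \<open>a\<close> may be infinite; the real numbers
    \<open>c < c'\<close> between them turn the gap into an admissible error.\<close>
  then obtain c where c: "M eps2 < ereal c" "ereal c < a" using ereal_dense2 by blast
  then obtain c' where c': "ereal c < ereal c'" "ereal c' < a" using ereal_dense2 by blast
  then have "0 < c' - c" by simp
  from assms[OF this] obtain e where e: "0 < e"
    "\<And>eps1 eps2. 0 < eps1 \<Longrightarrow> eps1 < e \<Longrightarrow> eps1 \<le> eps2 \<Longrightarrow> M eps1 \<le> M eps2 + ereal (c' - c)" by blast
  have "M eps < a" if "0 < eps" "eps < min e eps2" for eps
  proof -
    have "M eps \<le> M eps2 + ereal (c' - c)" using that by (intro e) auto
    also have "\<dots> \<le> ereal c + ereal (c' - c)" using c by (intro add_right_mono) simp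
    also have "\<dots> < a" using c' by simp
    finally show ?thesis .
  qed
  then show "\<forall>\<^sub>F eps in at_right 0. M eps < a"
    using e(1) e2(1) by (auto simp: eventually_at_right_field intro!: exI[of _ "min e eps2"])
qed

text \<open>Rescaling the argument by a fixed positive factor does not change a limit at 0, so the
  bounds may be taken at scales that differ by constant factors.\<close>

lemma tendsto_at_right_between_quasi:
  fixes M S :: "real \<Rightarrow> ereal"
  assumes M: "(M \<longlongrightarrow> L) (at_right 0)" and ab: "0 < a" "0 < b"
    and lower: "\<And>eta. 0 < eta \<Longrightarrow> \<forall>\<^sub>F eps in at_right 0. M (a * eps) \<le> S eps + ereal eta"
    and upper: "\<And>eps. 0 < eps \<Longrightarrow> S eps \<le> M (b * eps)"
  shows "(S \<longlongrightarrow> L) (at_right 0)"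
proof -
  have scale: "((\<lambda>eps. M (r * eps)) \<longlongrightarrow> L) (at_right 0)" if "0 < r" for r
  proof (rule filterlim_compose[OF M])
    have "((\<lambda>eps. r * eps) \<longlongrightarrow> r * 0) (at_right 0)" by (intro tendsto_intros)
    moreover have "\<forall>\<^sub>F eps in at_right 0. r * eps \<in> {0<..} \<and> r * eps \<noteq> 0"
      using that by (auto simp: eventually_at_right_field intro: exI[of _ 1])
    ultimately show "filterlim (\<lambda>eps. r * eps) (at_right 0) (at_right 0)"
      by (simp add: filterlim_at)
  qed
  show ?thesis
  proof (rule order_tendstoI)
    fix y assume y: "L < y"
    have "\<forall>\<^sub>F eps in at_right 0. M (b * eps) < y" using scale[OF ab(2)] y by (rule order_tendstoD)
    moreover have "\<forall>\<^sub>F eps in at_right 0. S eps \<le> M (b * eps)"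
      using upper by (auto simp: eventually_at_right_field intro: exI[of _ 1])
    ultimately show "\<forall>\<^sub>F eps in at_right 0. S eps < y" by eventually_elim simp
  next
    fix y assume "y < L"
    then obtain c where c: "y < ereal c" "ereal c < L" using ereal_dense2 by blast
    then obtain c' where c': "ereal c < ereal c'" "ereal c' < L" using ereal_dense2 by blast
    then have "0 < c' - c" by simp
    from lower[OF this] have "\<forall>\<^sub>F eps in at_right 0. M (a * eps) \<le> S eps + ereal (c' - c)" .
    moreover have "\<forall>\<^sub>F eps in at_right 0. ereal c' < M (a * eps)" using scale[OF ab(1)] c'(2) by (rule order_tendstoD)
    ultimately show "\<forall>\<^sub>F eps in at_right 0. y < S eps"
    proof eventually_elim
      case (elim eps)
      then have "ereal c' < S eps + ereal (c' - c)" by order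
      then have "ereal c < S eps" by (cases "S eps") auto
      then show ?case using c(1) by order
    qed
  qed
qed

theorem mainTheorem1:
  fixes T :: "'a::metric_space \<Rightarrow> 'a" and phi :: "nat \<Rightarrow> 'a \<Rightarrow> real" and Z :: "'a set"
  assumes "compact (UNIV :: 'a set)"
    and "continuous_on UNIV T"
    and "\<And>n. continuous_on UNIV (phi n)"
    and "compact Z" and "Z \<noteq> {}"
    and "tempered_distortion T phi"
  shows "(Meps T phi Z \<longlongrightarrow> neutral_bowen_pressure T phi Z) (at_right 0)
    \<and> ((\<lambda>eps. SUP \<mu>\<in>probs_on Z. lowerBK \<mu> T phi eps) \<longlongrightarrow> neutral_bowen_pressure T phi Z) (at_right 0)
    \<and> ((\<lambda>eps. SUP \<mu>\<in>probs_on Z. katok \<mu> T phi eps) \<longlongrightarrow> neutral_bowen_pressure T phi Z) (at_right 0)"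
proof -
  interpret compact_system T phi using assms(1-3) by unfold_locales
  let ?M = "Meps T phi Z" and ?P = "neutral_bowen_pressure T phi Z"
  let ?BK = "\<lambda>eps. SUP \<mu>\<in>probs_on Z. lowerBK \<mu> T phi eps"
  let ?K = "\<lambda>eps. SUP \<mu>\<in>probs_on Z. katok \<mu> T phi eps"
  have lim: "(?M \<longlongrightarrow> (INF eps\<in>{0<..}. ?M eps)) (at_right 0)"
  proof (rule tendsto_at_right_Inf_of_quasi_mono)
    fix eta :: real assume "0 < eta"
    then obtain e where e: "0 < e"
      "\<And>eps. 0 < eps \<Longrightarrow> eps < e \<Longrightarrow> \<exists>N. \<forall>n\<ge>N. distortion T phi n eps \<le> real n * eta"
      using tempered_distortion_le[OF assms(6)] by blast
    have "?M eps1 \<le> ?M eps2 + ereal eta" if eps: "0 < eps1" "eps1 < e" "eps1 \<le> eps2" for eps1 eps2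
      using e(2)[OF eps(1,2)] Meps_le_Meps_add[OF eps(3)] by blast
    then show "\<exists>e>0. \<forall>eps1 eps2. 0 < eps1 \<longrightarrow> eps1 < e \<longrightarrow> eps1 \<le> eps2 \<longrightarrow> ?M eps1 \<le> ?M eps2 + ereal eta"
      using e(1) by blast
  qed
  then have "?P = (INF eps\<in>{0<..}. ?M eps)"
    unfolding neutral_bowen_pressure_def by (intro tendsto_Lim) auto
  with lim have M: "(?M \<longlongrightarrow> ?P) (at_right 0)" by simp
  have BK_K: "?BK eps \<le> ?K (2 * eps)" if "0 < eps" for eps
    using lowerBK_le_katok that by (intro SUP_mono) (auto simp: probs_on_def)
  have K_M: "?K eps \<le> ?M eps" for eps by (intro SUP_least katok_le_Meps)
  \<comment> \<open>The factor \<open>r\<close> is left free because \<open>?BK\<close> is needed at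
    scale \<open>eps\<close> (\<open>r = 1/2\<close>) and at scale \<open>eps / 2\<close>
    (\<open>r = 1/4\<close>). The threshold \<open>e / (2 * r)\<close> keeps both
    \<open>r * eps\<close> and \<open>2 * (r * eps)\<close> below \<open>e\<close>.\<close>
  have M_BK: "\<forall>\<^sub>F eps in at_right 0. ?M (r * eps) \<le> ?BK (2 * (r * eps)) + ereal eta" if eta: "0 < eta" and r: "0 < r" for eta r
  proof -
    have "0 < eta / 3" using eta by simp
    then obtain e where e: "0 < e"
      "\<And>eps. 0 < eps \<Longrightarrow> eps < e \<Longrightarrow> \<exists>N. \<forall>n\<ge>N. distortion T phi n eps \<le> real n * (eta / 3)"
      using tempered_distortion_le[OF assms(6)] by blast
    have "?M (r * eps) \<le> ?BK (2 * (r * eps)) + ereal eta" if "0 < eps" "eps < e / (2 * r)" for eps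
    proof -
      have lt: "0 < r * eps" "2 * (r * eps) < e" using that r by (auto simp: less_divide_eq ac_simps)
      obtain N1 where N1: "\<forall>n\<ge>N1. distortion T phi n (r * eps) \<le> real n * (eta / 3)"
        using e(2)[of "r * eps"] lt by auto
      obtain N2 where N2: "\<forall>n\<ge>N2. distortion T phi n (2 * (r * eps)) \<le> real n * (eta / 3)"
        using e(2)[of "2 * (r * eps)"] lt by auto
      have "?M (r * eps) \<le> ?BK (2 * (r * eps)) + ereal (3 * (eta / 3))"
        by (rule Meps_le_SUP_lowerBK[of "eta / 3" "r * eps" "max N1 N2"])
           (use eta lt N1 N2 assms(4) in auto)
      then show ?thesis by simp
    qed
    then show ?thesis using e(1) r
      by (auto simp: eventually_at_right_field intro!: exI[of _ "e / (2 * r)"])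
  qed
  \<comment> \<open>The chain is \<open>?M (eps / 2) \<le> ?BK eps + eta\<close> and
    \<open>?BK eps \<le> ?K (2 * eps) \<le> ?M (2 * eps)\<close>.\<close>
  have "(?BK \<longlongrightarrow> ?P) (at_right 0)"
  proof (rule tendsto_at_right_between_quasi[OF M, of "1/2" 2])
    show "\<forall>\<^sub>F eps in at_right 0. ?M (1 / 2 * eps) \<le> ?BK eps + ereal eta" if "0 < eta" for eta
      using M_BK[OF that, of "1/2"] by simp
    show "?BK eps \<le> ?M (2 * eps)" if "0 < eps" for eps
      using BK_K[OF that] K_M by (rule order_trans)
  qed auto
  \<comment> \<open>The lower bound passes through \<open>?BK (eps / 2)\<close>, which costs one
    more factor 2 in the scale.\<close>
  moreover have "(?K \<longlongrightarrow> ?P) (at_right 0)"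
  proof (rule tendsto_at_right_between_quasi[OF M, of "1/4" 1])
    show "\<forall>\<^sub>F eps in at_right 0. ?M (1 / 4 * eps) \<le> ?K eps + ereal eta" if "0 < eta" for eta
    proof -
      have "\<forall>\<^sub>F eps in at_right 0. (0::real) < eps" by (rule eventually_at_right_less)
      with M_BK[OF that, of "1/4", simplified] show ?thesis
      proof eventually_elim
        case (elim eps)
        have "?BK (eps / 2) + ereal eta \<le> ?K eps + ereal eta"
          using BK_K[of "eps / 2"] elim by (intro add_right_mono) auto
        then show ?case using elim by (auto intro: order_trans)
      qed
    qed
    show "?K eps \<le> ?M (1 * eps)" if "0 < eps" for eps using K_M by simp
  qed auto
  ultimately show ?thesis using M by blast
qed

end
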